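(* Let $n>m$ be two positive integers. Then for every integer $k\geqslant 0$, every measure equivalence coupling from $\mathbb{Z}^n$ to $\mathbb{Z}^m$ is not $\varpi^{(k)}_{m/n}$-integrable.
   Context: **Functions.** $\log^{(1)}(t)=\log t$, $\log^{(j+1)}(t)=\log(\log^{(j)}(t))$ for $t$ sufficiently large, $\Lambda_k(t)=\prod_{j=1}^k\log^{(j)}(t)$ for $k\geqslant 1$, and $\Lambda_0(t)=1$. For real $\alpha>0$ and an integer $k\geqslant 0$, fix $T=T_{\alpha,k}>0$ such that $t\mapsto t^\alpha/\Lambda_k(t)$ is defined with all $\log^{(j)}(t)>0$ ($1\leqslant j\leqslant k$), continuous, positive and increasing on $[T,+\infty)$ (such $T$ exists). Define $\varpi^{(k)}_\alpha:\mathbb{R}_{\geqslant 0}\to\mathbb{R}$ by $\varpi^{(k)}_\alpha(t)=t^\alpha/\Lambda_k(t)$ for $t\geqslant T$ and $\varpi^{(k)}_\alpha(t)=T^\alpha/\Lambda_k(T)$ for $0\leqslant t<T$. **Measure equivalence couplings.** A standard measure space $(X,\mu)$ is a standard Borel space with a non-zero $\sigma$-finite measure. For a countable group $G$ acting measurably on $(X,\mu)$, the action is (essentially) free if for $\mu$-a.e. $x$ one has $gx\neq x$ for all $g\neq e_G$; a fundamental domain is a Borel set $X_G\subset X$ with $|X_G\cap Gx|=1$ for $\mu$-a.e. $x$; the action is smooth if it admits a fundamental domain. A measure equivalence coupling from $G$ to $H$ is a quadruple $\mathcal{C}=(X,X_G,X_H,\mu)$ where $(X,\mu)$ is a standard measure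 space with free, measure-preserving, smooth actions of $G$ and $H$ that commute (for $\mu$-a.e. $x$, $hgx=ghx$ for all $g\in G,h\in H$), $X_G$ and $X_H$ are fundamental domains for the $G$- and $H$-actions respectively, and $\mu(X_G),\mu(X_H)<\infty$. The induced action $G\curvearrowright(X_H,\mu|_{X_H})$, denoted $g\star x$, is determined (for a.e. $x\in X_H$) by $\{g\star x\}=X_H\cap H(gx)$ for all $g\in G$. The cocycle $\kappa^{\mathcal{C}}:G\times X_H\to H$ is determined (for a.e. $x\in X_H$) by $\kappa^{\mathcal{C}}(g,x)(gx)=g\star x$ for all $g\in G$. **Integrability.** Let $\omega:\mathbb{R}_{\geqslant 0}\to\mathbb{R}_{\geqslant 0}$ be non-decreasing, $G,H$ finitely generated, and $|\cdot|_H$ a word length on $H$ (for $H=\mathbb{Z}^m$: the sum of the absolute values of the coordinates). The coupling $\mathcal{C}$ from $G$ to $H$ is $\omega$-integrable if for every $g\in G$ there is $c_g>0$ with $\int_{X_H}\omega\left(|\kappa^{\mathcal{C}}(g,x)|_H/c_g\right)\,\mathrm{d}\mu(x)<\infty$. *)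

theory Defs
  imports "HOL-Analysis.Analysis"
begin

section \<open>Gauge functions\<close>

definition iter_log :: "nat \<Rightarrow> real \<Rightarrow> real" where
  "iter_log j t = (ln ^^ j) t"

definition Lambda :: "nat \<Rightarrow> real \<Rightarrow> real" where
  "Lambda k t = (\<Prod>j\<in>{1..k}. iter_log j t)"

text \<open>
  Since \<^const>\<open>ln\<close> is total in HOL, being defined has to be made explicit: for \<open>t > 0\<close>, all the
  iterated logarithms up to order \<open>k\<close> being positive guarantees that each of them is formed from a
  positive argument.
\<close>

definition admissible_threshold :: "real \<Rightarrow> nat \<Rightarrow> real \<Rightarrow> bool" where
  "admissible_threshold \<alpha> k T \<longleftrightarrow>
     T > 0 \<and>
     (\<forall>t\<ge>T. \<forall>j\<in>{1..k}. iter_log j t > 0) \<and>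
     continuous_on {T..} (\<lambda>t. t powr \<alpha> / Lambda k t) \<and>
     (\<forall>t\<ge>T. t powr \<alpha> / Lambda k t > 0) \<and>
     strict_mono_on {T..} (\<lambda>t. t powr \<alpha> / Lambda k t)"

text \<open>The threshold is a parameter; only the values at \<open>t \<ge> 0\<close> are meaningful.\<close>

definition varpi :: "real \<Rightarrow> nat \<Rightarrow> real \<Rightarrow> real \<Rightarrow> real" where
  "varpi \<alpha> k T t =
     (if t \<ge> T then t powr \<alpha> / Lambda k t else T powr \<alpha> / Lambda k T)"


section \<open>Standard measure spaces and group actions\<close>

definition standard_borel_space :: "'x measure \<Rightarrow> bool" where
  "standard_borel_space M \<longleftrightarrow>
     (\<exists>\<T>. completely_metrizable_space \<T> \<and> separable_space \<T> \<and>
        topspace \<T> = space M \<and> sets M = sigma_sets (space M) {U. openin \<T> U})"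

definition standard_measure_space :: "'x measure \<Rightarrow> bool" where
  "standard_measure_space M \<longleftrightarrow>
     standard_borel_space M \<and> sigma_finite_measure M \<and> emeasure M (space M) \<noteq> 0"

text \<open>
  Groups are written additively; the class \<^class>\<open>group_add\<close> does not include commutativity.
  An action of such a group is a curried function, with \<open>a g x\<close> standing for \<open>g x\<close>.
\<close>

definition orbit :: "('g \<Rightarrow> 'x \<Rightarrow> 'x) \<Rightarrow> 'x \<Rightarrow> 'x set" where
  "orbit a x = range (\<lambda>g. a g x)"

definition measurable_action ::
    "'x measure \<Rightarrow> ('g::{group_add,countable} \<Rightarrow> 'x \<Rightarrow> 'x) \<Rightarrow> bool" where
  "measurable_action M a \<longleftrightarrow>
     (\<forall>g. a g \<in> measurable M M) \<and>
     (\<forall>x\<in>space M. a 0 x = x) \<and>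
     (\<forall>g h. \<forall>x\<in>space M. a (g + h) x = a g (a h x))"

definition measure_preserving_action ::
    "'x measure \<Rightarrow> ('g::{group_add,countable} \<Rightarrow> 'x \<Rightarrow> 'x) \<Rightarrow> bool" where
  "measure_preserving_action M a \<longleftrightarrow>
     measurable_action M a \<and> (\<forall>g. distr M M (a g) = M)"

definition essentially_free ::
    "'x measure \<Rightarrow> ('g::{group_add,countable} \<Rightarrow> 'x \<Rightarrow> 'x) \<Rightarrow> bool" where
  "essentially_free M a \<longleftrightarrow> (AE x in M. \<forall>g. g \<noteq> 0 \<longrightarrow> a g x \<noteq> x)"

definition fundamental_domain ::
    "'x measure \<Rightarrow> ('g::{group_add,countable} \<Rightarrow> 'x \<Rightarrow> 'x) \<Rightarrow> 'x set \<Rightarrow> bool" where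
  "fundamental_domain M a F \<longleftrightarrow>
     F \<in> sets M \<and> (AE x in M. card (F \<inter> orbit a x) = 1)"

definition smooth_action ::
    "'x measure \<Rightarrow> ('g::{group_add,countable} \<Rightarrow> 'x \<Rightarrow> 'x) \<Rightarrow> bool" where
  "smooth_action M a \<longleftrightarrow> (\<exists>F. fundamental_domain M a F)"


section \<open>Measure equivalence couplings\<close>

text \<open>
  \<open>me_coupling M a b X\<^sub>G X\<^sub>H\<close> says that \<open>(X, X\<^sub>G, X\<^sub>H, \<mu>)\<close>, with \<open>(X, \<mu>)\<close> given by \<open>M\<close>, is a coupling
  from \<open>G\<close> to \<open>H\<close>, where \<open>a\<close> is the action of \<open>G\<close> and \<open>b\<close> the action of \<open>H\<close>.
\<close>

definition me_coupling ::
    "'x measure \<Rightarrow> ('g::{group_add,countable} \<Rightarrow> 'x \<Rightarrow> 'x) \<Rightarrow>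
     ('h::{group_add,countable} \<Rightarrow> 'x \<Rightarrow> 'x) \<Rightarrow> 'x set \<Rightarrow> 'x set \<Rightarrow> bool" where
  "me_coupling M a b X\<^sub>G X\<^sub>H \<longleftrightarrow>
     standard_measure_space M \<and>
     measure_preserving_action M a \<and> essentially_free M a \<and> smooth_action M a \<and>
     measure_preserving_action M b \<and> essentially_free M b \<and> smooth_action M b \<and>
     (AE x in M. \<forall>g h. b h (a g x) = a g (b h x)) \<and>
     fundamental_domain M a X\<^sub>G \<and> fundamental_domain M b X\<^sub>H \<and>
     emeasure M X\<^sub>G < \<infinity> \<and> emeasure M X\<^sub>H < \<infinity>"

text \<open>
  For a coupling, the descriptions below are uniquely satisfied for almost every \<open>x \<in> X\<^sub>H\<close>
  (and all \<open>g\<close>); on the remaining null set the values are unspecified.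
\<close>

definition induced_action ::
    "('g \<Rightarrow> 'x \<Rightarrow> 'x) \<Rightarrow> ('h \<Rightarrow> 'x \<Rightarrow> 'x) \<Rightarrow> 'x set \<Rightarrow> 'g \<Rightarrow> 'x \<Rightarrow> 'x" where
  "induced_action a b X\<^sub>H g x = (THE y. {y} = X\<^sub>H \<inter> orbit b (a g x))"

definition cocycle ::
    "('g \<Rightarrow> 'x \<Rightarrow> 'x) \<Rightarrow> ('h \<Rightarrow> 'x \<Rightarrow> 'x) \<Rightarrow> 'x set \<Rightarrow> 'g \<Rightarrow> 'x \<Rightarrow> 'h" where
  "cocycle a b X\<^sub>H g x = (THE h. b h (a g x) = induced_action a b X\<^sub>H g x)"

text \<open>
  Here \<open>len\<close> is the word length on \<open>H\<close>. The gauge \<open>\<omega>\<close> is only evaluated at nonnegative reals and is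
  meant to be nonnegative there, so that \<^const>\<open>ennreal\<close> does not truncate.
\<close>

definition me_integrable ::
    "(real \<Rightarrow> real) \<Rightarrow> ('h \<Rightarrow> nat) \<Rightarrow> 'x measure \<Rightarrow> ('g \<Rightarrow> 'x \<Rightarrow> 'x) \<Rightarrow>
     ('h \<Rightarrow> 'x \<Rightarrow> 'x) \<Rightarrow> 'x set \<Rightarrow> bool" where
  "me_integrable \<omega> len M a b X\<^sub>H \<longleftrightarrow>
     (\<forall>g. \<exists>c>0. (\<integral>\<^sup>+x\<in>X\<^sub>H. ennreal (\<omega> (real (len (cocycle a b X\<^sub>H g x)) / c)) \<partial>M) < \<infinity>)"

definition int_vec_length :: "int ^ 'm \<Rightarrow> nat" where
  "int_vec_length v = (\<Sum>i\<in>UNIV. nat \<bar>v $ i\<bar>)"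

end

theory Submission
  imports Defs
begin

text \<open>
  Put \<open>p = m / n < 1\<close> and suppose that the coupling is integrable for the gauge
  \<open>t\<^sup>p / \<Lambda>\<^sub>k(t)\<close>. The contradiction comes from comparing, at one well-chosen scale \<open>t\<close>, two
  estimates for the number of \<open>g\<close> in the box \<open>[0, r)\<^sup>n\<close>, with \<open>r\<close> about \<open>K t\<^sup>p\<close>, for which
  \<open>\<kappa>(g, x)\<close> has length less than \<open>t\<close>.

  \<^bold>\<open>Few short values.\<close> The set of \<open>g\<close> with \<open>\<kappa>(g, x) = h\<close> is the set of times at which the
  \<open>G\<close>-orbit of \<open>h x\<close> visits \<open>X\<^sub>H\<close>. Almost every \<open>G\<close>-orbit visits \<open>X\<^sub>H\<close> only finitely often, since by
  mass transport the number of visits has integral \<open>\<mu>(X\<^sub>H)\<close> over a fundamental domain of \<open>G\<close>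
  (\<open>AE_finite_visits\<close>). Counting only those \<open>g\<close> that send \<open>x\<close> into the part of \<open>X\<^sub>H\<close> where the number
  of visits is at most \<open>L\<close>, there are at most \<open>L\<close> of them for each \<open>h\<close>, hence \<open>O(t\<^sup>m)\<close> in total
  (\<open>card_short_le\<close>). That part of \<open>X\<^sub>H\<close> has positive measure for large \<open>L\<close>, and the induced action
  preserves the measure, so integrating over \<open>x\<close> shows that \<open>\<kappa>(g, x)\<close> cannot be short with
  probability close to one for all \<open>g\<close> in the box, once \<open>K\<^sup>n\<close> exceeds a constant
  (\<open>counting_inequality\<close>).

  \<^bold>\<open>Most values are short.\<close> The length truncated at \<open>t\<close> is still subadditive, so by the cocycle
  identity \<open>J(g) = \<integral> min(|\<kappa>(g, x)|, t) d\<mu>(x)\<close> is a subadditive function of \<open>g\<close>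
  (\<open>truncated_length_add\<close>). On the box it is at most \<open>n r\<close> times its largest value on the generators.
  By Markov's inequality it is enough to find large \<open>t\<close> at which the truncated moments of the
  generators are a small multiple of \<open>t powr (1 - p)\<close>.

  \<^bold>\<open>The good scale.\<close> Such \<open>t\<close> exist because \<open>1 / (t \<Lambda>\<^sub>k(t))\<close> is the derivative of the iterated
  logarithm of order \<open>k + 1\<close>, which tends to infinity. Were \<open>\<integral> min(f, t) \<ge> \<epsilon> t powr (1 - p)\<close> for all
  large \<open>t\<close>, then integrating against \<open>t powr (p - 2) / \<Lambda>\<^sub>k(t)\<close> would give infinity, whereas by Tonelli
  the result is bounded by a multiple of the integral of \<open>f\<^sup>p / \<Lambda>\<^sub>k(f)\<close>
  (\<open>weighted_integral_truncation_le\<close>, \<open>truncated_moment_small\<close>). Only the divergence of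
  \<open>\<integral> dt / (t \<Lambda>\<^sub>k(t))\<close> matters, which is why every \<open>k\<close> is covered.

  To avoid carrying null sets through these arguments, they are made for couplings whose
  properties hold everywhere (\<open>strict_coupling\<close>); removing an invariant null set brings an
  arbitrary coupling to this form (\<open>me_coupling_strict\<close>).
\<close>

section \<open>Iterated logarithms\<close>

lemma iter_log_0 [simp]: "iter_log 0 t = t"
  by (simp add: iter_log_def)

lemma iter_log_Suc: "iter_log (Suc j) t = ln (iter_log j t)"
  by (simp add: iter_log_def)

lemma Lambda_0 [simp]: "Lambda 0 t = 1"
  by (simp add: Lambda_def)

lemma Lambda_Suc: "Lambda (Suc k) t = Lambda k t * iter_log (Suc k) t"
  by (simp add: Lambda_def)

lemma iter_log_measurable [measurable]: "iter_log j \<in> borel_measurable borel"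
proof (induction j)
  case (Suc j)
  then have "(\<lambda>t. ln (iter_log j t)) \<in> borel_measurable borel"
    by measurable
  moreover have "iter_log (Suc j) = (\<lambda>t. ln (iter_log j t))"
    by (rule ext) (simp add: iter_log_Suc)
  ultimately show ?case
    by simp
qed (simp add: iter_log_def)

lemma Lambda_measurable [measurable]: "Lambda k \<in> borel_measurable borel"
proof -
  have "Lambda k = (\<lambda>t. \<Prod>j\<in>{1..k}. iter_log j t)"
    by (rule ext) (simp add: Lambda_def)
  then show ?thesis
    by simp
qed

lemma Lambda_pos: "(\<And>j. j \<in> {1..k} \<Longrightarrow> iter_log j t > 0) \<Longrightarrow> Lambda k t > 0"
  unfolding Lambda_def by (rule prod_pos) auto

lemma filterlim_iter_log: "filterlim (iter_log j) at_top at_top"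
proof (induction j)
  case 0
  have "iter_log 0 = (\<lambda>t. t)"
    by (rule ext) simp
  then show ?case
    by (simp add: filterlim_ident)
next
  case (Suc j)
  have "iter_log (Suc j) = (\<lambda>t. ln (iter_log j t))"
    by (rule ext) (simp add: iter_log_Suc)
  then show ?case
    using filterlim_compose[OF ln_at_top Suc] by simp
qed

lemma filterlim_Lambda: "filterlim (Lambda (Suc k)) at_top at_top"
proof (induction k)
  case 0
  have "Lambda (Suc 0) = iter_log (Suc 0)"
    by (rule ext) (simp add: Lambda_Suc)
  then show ?case
    using filterlim_iter_log by simp
next
  case (Suc k)
  have "Lambda (Suc (Suc k)) = (\<lambda>t. Lambda (Suc k) t * iter_log (Suc (Suc k)) t)"
    by (rule ext) (rule Lambda_Suc)
  then show ?case
    using filterlim_at_top_mult_at_top[OF Suc filterlim_iter_log] by simp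
qed

lemma has_derivative_iter_log:
  assumes "t > 0" and "\<And>j. j \<in> {1..k} \<Longrightarrow> iter_log j t > 0"
  shows "(iter_log (Suc k) has_real_derivative 1 / (t * Lambda k t)) (at t)"
  using assms(2)
proof (induction k)
  case 0
  have "iter_log (Suc 0) = ln"
    by (rule ext) (simp add: iter_log_Suc)
  then show ?case
    using \<open>t > 0\<close> by (auto intro!: derivative_eq_intros)
next
  case (Suc k)
  have eq: "iter_log (Suc (Suc k)) = (\<lambda>t. ln (iter_log (Suc k) t))"
    by (rule ext) (rule iter_log_Suc)
  have pos: "iter_log (Suc k) t > 0"
    using Suc.prems by simp
  have "(iter_log (Suc k) has_real_derivative 1 / (t * Lambda k t)) (at t)"
    using Suc by simp
  then show ?case
    unfolding eq Lambda_Suc using pos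
    by (auto intro!: derivative_eq_intros simp: field_simps)
qed

text \<open>
  The quantity \<open>t \<Lambda>\<^sub>k'(t) / \<Lambda>\<^sub>k(t)\<close>: the amount by which dividing by \<open>\<Lambda>\<^sub>k\<close> lowers the effective
  exponent of a power of \<open>t\<close>. Since it tends to zero, \<open>\<Lambda>\<^sub>k\<close> behaves like a constant when powers
  of \<open>t\<close> divided by it are integrated.
\<close>

definition log_defect :: "nat \<Rightarrow> real \<Rightarrow> real" where
  "log_defect k t = (\<Sum>j\<in>{1..k}. 1 / Lambda j t)"

lemma log_defect_measurable [measurable]: "log_defect k \<in> borel_measurable borel"
proof -
  have "log_defect k = (\<lambda>t. \<Sum>j\<in>{1..k}. 1 / Lambda j t)"
    by (rule ext) (simp add: log_defect_def)
  then show ?thesis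
    by simp
qed

lemma log_defect_tendsto_0: "(log_defect k \<longlongrightarrow> 0) at_top"
proof -
  have "((\<lambda>t. \<Sum>j\<in>{1..k}. 1 / Lambda j t) \<longlongrightarrow> (\<Sum>j\<in>{1..k}. 0)) at_top"
  proof (rule tendsto_sum)
    fix j assume "j \<in> {1..k}"
    then obtain i where "j = Suc i"
      by (cases j) auto
    then show "((\<lambda>t. 1 / Lambda j t) \<longlongrightarrow> 0) at_top"
      using filterlim_Lambda[of i] by (auto intro: real_tendsto_divide_at_top)
  qed
  moreover have "log_defect k = (\<lambda>t. \<Sum>j\<in>{1..k}. 1 / Lambda j t)"
    by (rule ext) (simp add: log_defect_def)
  ultimately show ?thesis
    by simp
qed

lemma log_defect_nonneg:
  assumes "\<And>j. j \<in> {1..k} \<Longrightarrow> iter_log j t > 0"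
  shows "log_defect k t \<ge> 0"
  unfolding log_defect_def
  by (intro sum_nonneg divide_nonneg_nonneg less_imp_le[OF Lambda_pos]) (use assms in auto)

lemma has_derivative_Lambda:
  assumes "t > 0" and "\<And>j. j \<in> {1..k} \<Longrightarrow> iter_log j t > 0"
  shows "(Lambda k has_real_derivative Lambda k t * log_defect k t / t) (at t)"
  using assms(2)
proof (induction k)
  case 0
  have "Lambda 0 = (\<lambda>t. 1)"
    by (rule ext) simp
  then show ?case
    by (simp add: log_defect_def)
next
  case (Suc k)
  have eq: "Lambda (Suc k) = (\<lambda>t. Lambda k t * iter_log (Suc k) t)"
    by (rule ext) (rule Lambda_Suc)
  have IH: "(Lambda k has_real_derivative Lambda k t * log_defect k t / t) (at t)"
    using Suc by simp
  have log: "(iter_log (Suc k) has_real_derivative 1 / (t * Lambda k t)) (at t)"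
    using has_derivative_iter_log[OF \<open>t > 0\<close>, of k] Suc.prems by simp
  have "Lambda k t > 0" "iter_log (Suc k) t > 0"
    using Suc.prems by (auto intro: Lambda_pos)
  then show ?case
    unfolding eq log_defect_def sum.cl_ivl_Suc using \<open>t > 0\<close>
    by (auto intro!: derivative_eq_intros IH log
        simp: Lambda_Suc log_defect_def field_simps)
qed

lemma has_derivative_powr_over_Lambda:
  assumes "t > 0" and "\<And>j. j \<in> {1..k} \<Longrightarrow> iter_log j t > 0"
  shows "((\<lambda>t. t powr s / Lambda k t) has_real_derivative
           t powr (s - 1) / Lambda k t * (s - log_defect k t)) (at t)"
proof -
  have "Lambda k t > 0"
    using assms(2) by (rule Lambda_pos)
  then show ?thesis
    using \<open>t > 0\<close>
    by (auto intro!: derivative_eq_intros has_derivative_Lambda assms(2)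
        simp: field_simps power2_eq_square powr_diff)
qed

section \<open>Truncated moments at a critical exponent\<close>

text \<open>
  The weight turns truncations into the critical gauge. For \<open>t \<le> w\<close> the integrand is at most
  \<open>t powr (p - 1) / \<Lambda>\<^sub>k(t)\<close>, and for \<open>t \<ge> w\<close> at most \<open>w t powr (p - 2) / \<Lambda>\<^sub>k(t)\<close>. Because the
  logarithmic defect lies between \<open>0\<close> and \<open>p / 2\<close>, these are dominated by the derivatives of multiples
  of \<open>t powr p / \<Lambda>\<^sub>k(t)\<close> and of \<open>t powr (p - 1) / \<Lambda>\<^sub>k(t)\<close>; both boundary terms at \<open>w\<close> are multiples
  of \<open>w powr p / \<Lambda>\<^sub>k(w)\<close>. The condition \<open>p < 1\<close> makes the last function decreasing.
\<close>

lemma weighted_integral_truncation_le: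
  fixes p R U y w :: real
  assumes p: "0 < p" "p < 1" and "R > 0"
    and pos: "\<And>t j. t \<ge> R \<Longrightarrow> j \<in> {1..k} \<Longrightarrow> iter_log j t > 0"
    and defect: "\<And>t. t \<ge> R \<Longrightarrow> log_defect k t \<le> p / 2"
    and w: "w \<ge> R" "w \<ge> y"
  shows "(\<integral>\<^sup>+t. ennreal (t powr (p - 2) * min y t / Lambda k t) * indicator {R..U} t \<partial>lborel)
           \<le> ennreal ((2 / p + 1 / (1 - p)) * (w powr p / Lambda k w))"
proof -
  define V where "V = max w U"
  \<comment> \<open>\<open>F1\<close> is the primitive used on \<open>[R, w]\<close> and \<open>F2\<close> the one used on \<open>[w, V]\<close>, where \<open>V\<close> allows for \<open>U < w\<close>.\<close>
  define f1 where "f1 t = (2 / p) * (t powr (p - 1) / Lambda k t * (p - log_defect k t))" for t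
  define F1 where "F1 t = (2 / p) * (t powr p / Lambda k t)" for t
  define f2 where
    "f2 t = - (w / (1 - p)) * (t powr (p - 1 - 1) / Lambda k t * (p - 1 - log_defect k t))" for t
  define F2 where "F2 t = - (w / (1 - p)) * (t powr (p - 1) / Lambda k t)" for t
  have Lpos: "Lambda k t > 0" if "t \<ge> R" for t
    using pos that by (intro Lambda_pos) auto
  have defect0: "log_defect k t \<ge> 0" if "t \<ge> R" for t
    using pos that by (intro log_defect_nonneg) auto
  have [measurable]: "f1 \<in> borel_measurable borel" "f2 \<in> borel_measurable borel"
    unfolding f1_def f2_def by measurable
  have D: "(F1 has_real_derivative f1 t) (at t)" "(F2 has_real_derivative f2 t) (at t)"
    if "t \<ge> R" for t
    unfolding F1_def f1_def F2_def f2_def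
    by (rule DERIV_cmult[OF has_derivative_powr_over_Lambda];
        use that \<open>R > 0\<close> pos in auto)+
  have lower1: "t powr (p - 1) / Lambda k t \<le> f1 t" if "t \<ge> R" for t
  proof -
    have "t powr (p - 1) / Lambda k t * 1 \<le> t powr (p - 1) / Lambda k t * ((2 / p) * (p - log_defect k t))"
      using Lpos[OF that] defect[OF that] p by (intro mult_left_mono) (auto simp: field_simps)
    moreover have "f1 t = t powr (p - 1) / Lambda k t * ((2 / p) * (p - log_defect k t))"
      unfolding f1_def by (simp only: mult_ac)
    ultimately show ?thesis
      by simp
  qed
  have lower2: "w * t powr (p - 2) / Lambda k t \<le> f2 t" if "t \<ge> R" for t
  proof -
    have "(w * t powr (p - 2) / Lambda k t) * 1
        \<le> (w * t powr (p - 2) / Lambda k t) * ((1 - p + log_defect k t) / (1 - p))"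
      using Lpos[OF that] defect0[OF that] p w \<open>R > 0\<close>
      by (intro mult_left_mono) (auto simp: field_simps)
    also have "\<dots> = f2 t"
    proof -
      have "- (w / (1 - p)) * (A * (p - 1 - q)) = w * A * ((1 - p + q) / (1 - p))" for A q
      proof -
        have neg: "A * (p - 1 - q) = - (A * (1 - p + q))"
          by (simp add: algebra_simps)
        show ?thesis
          unfolding neg by simp
      qed
      then show ?thesis
        by (simp add: f2_def)
    qed
    finally show ?thesis
      by simp
  qed
  have f1_nonneg: "f1 t \<ge> 0" if "t \<ge> R" for t
    using lower1[OF that] Lpos[OF that]
    by (meson divide_nonneg_pos order_trans powr_ge_zero)
  have f2_nonneg: "f2 t \<ge> 0" if "t \<ge> R" for t
  proof -
    have "0 \<le> w * t powr (p - 2) / Lambda k t"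
      using Lpos[OF that] w \<open>R > 0\<close> by (intro divide_nonneg_pos) auto
    then show ?thesis
      using lower2[OF that] by linarith
  qed
  have pointwise: "ennreal (t powr (p - 2) * min y t / Lambda k t) * indicator {R..U} t
      \<le> ennreal (f1 t) * indicator {R..w} t + ennreal (f2 t) * indicator {w..V} t" for t
  proof (cases "t \<in> {R..U}")
    case True
    then have t: "t \<ge> R" "t > 0"
      using \<open>R > 0\<close> by auto
    show ?thesis
    proof (cases "t \<le> w")
      case True
      have "t powr (p - 2) * min y t \<le> t powr (p - 2) * t"
        by (intro mult_left_mono) auto
      also have "\<dots> = t powr (p - 1)"
        using \<open>t > 0\<close> by (simp add: powr_diff powr_numeral power2_eq_square)
      finally have "t powr (p - 2) * min y t / Lambda k t \<le> t powr (p - 1) / Lambda k t"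
        using Lpos[OF t(1)] by (intro divide_right_mono) auto
      then have "t powr (p - 2) * min y t / Lambda k t \<le> f1 t"
        using lower1[OF t(1)] by linarith
      then have "ennreal (t powr (p - 2) * min y t / Lambda k t) * indicator {R..U} t
          \<le> ennreal (f1 t) * indicator {R..w} t"
        using True t by (auto split: split_indicator intro: ennreal_leI)
      then show ?thesis
        by (rule order_trans) simp
    next
      case False
      have "t powr (p - 2) * min y t / Lambda k t \<le> w * t powr (p - 2) / Lambda k t"
        using Lpos[OF t(1)] w by (intro divide_right_mono) (auto simp: mult.commute[of w] mult.commute[of "min y t"] intro!: mult_left_mono)
      then have "t powr (p - 2) * min y t / Lambda k t \<le> f2 t"
        using lower2[OF t(1)] by linarith
      then have "ennreal (t powr (p - 2) * min y t / Lambda k t) * indicator {R..U} t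
          \<le> ennreal (f2 t) * indicator {w..V} t"
        using False \<open>t \<in> {R..U}\<close> by (auto split: split_indicator intro: ennreal_leI simp: V_def)
      then show ?thesis
        by (rule order_trans) simp
    qed
  qed simp
  have "(\<integral>\<^sup>+t. ennreal (t powr (p - 2) * min y t / Lambda k t) * indicator {R..U} t \<partial>lborel)
      \<le> (\<integral>\<^sup>+t. ennreal (f1 t) * indicator {R..w} t + ennreal (f2 t) * indicator {w..V} t \<partial>lborel)"
    by (intro nn_integral_mono pointwise)
  also have "\<dots> = (\<integral>\<^sup>+t. ennreal (f1 t) * indicator {R..w} t \<partial>lborel)
      + (\<integral>\<^sup>+t. ennreal (f2 t) * indicator {w..V} t \<partial>lborel)"
    by (intro nn_integral_add) auto
  also have "(\<integral>\<^sup>+t. ennreal (f1 t) * indicator {R..w} t \<partial>lborel) = F1 w - F1 R"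
    by (intro nn_integral_FTC_Icc) (use D f1_nonneg w in auto)
  also have "(\<integral>\<^sup>+t. ennreal (f2 t) * indicator {w..V} t \<partial>lborel) = F2 V - F2 w"
    by (intro nn_integral_FTC_Icc) (use D f2_nonneg w in \<open>auto simp: V_def\<close>)
  also have "ennreal (F1 w - F1 R) \<le> ennreal (F1 w)"
    using Lpos[of R] p by (intro ennreal_leI) (auto simp: F1_def)
  also have "ennreal (F2 V - F2 w) \<le> ennreal (- F2 w)"
  proof (rule ennreal_leI)
    have "Lambda k V > 0"
      using w by (intro Lpos) (simp add: V_def)
    then have "F2 V \<le> 0"
      using p w \<open>R > 0\<close> unfolding F2_def by (intro mult_nonpos_nonneg) auto
    then show "F2 V - F2 w \<le> - F2 w"
      by simp
  qed
  also have "ennreal (F1 w) + ennreal (- F2 w) = ennreal (F1 w + - F2 w)"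
    using Lpos[of w] p w \<open>R > 0\<close> by (intro ennreal_plus[symmetric]) (auto simp: F1_def F2_def)
  also have "F1 w + - F2 w = (2 / p + 1 / (1 - p)) * (w powr p / Lambda k w)"
  proof -
    have "w * w powr (p - 1) = w powr p"
      using w \<open>R > 0\<close> by (simp add: powr_diff)
    then show ?thesis
      by (simp add: F1_def F2_def algebra_simps)
  qed
  finally show ?thesis
    by (simp add: add_mono)
qed

lemma admissible_threshold_mono:
  assumes "admissible_threshold p k T" "T \<le> s" "s \<le> t"
  shows "s powr p / Lambda k s \<le> t powr p / Lambda k t"
proof -
  have "strict_mono_on {T..} (\<lambda>t. t powr p / Lambda k t)"
    using assms(1) by (simp add: admissible_threshold_def)
  from strict_mono_on_leD[OF this, of s t] show ?thesis
    using assms by auto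
qed

lemma varpi_nonneg: "admissible_threshold p k T \<Longrightarrow> varpi p k T t \<ge> 0"
  unfolding admissible_threshold_def varpi_def by (auto intro: less_imp_le)

lemma varpi_mono:
  assumes "admissible_threshold p k T" "s \<le> t"
  shows "varpi p k T s \<le> varpi p k T t"
  using admissible_threshold_mono[OF assms(1)] assms(2) unfolding varpi_def by auto

text \<open>
  A weak-type statement along a subsequence of scales. The gauge allows the tail of \<open>f\<close> to be too
  heavy at many scales, by logarithmic factors, so a bound for all large \<open>t\<close> is not available; but the
  truncated moment can stay large at all large scales only if \<open>\<integral> dt / (t \<Lambda>\<^sub>k(t))\<close> converges, which
  it does not.
\<close>

lemma truncated_moment_small:
  fixes p \<epsilon> R :: real and f :: "'x \<Rightarrow> real"
  assumes p: "0 < p" "p < 1" and thr: "admissible_threshold p k T"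
    and "finite_measure P" and [measurable]: "f \<in> borel_measurable P" and f_nonneg: "\<And>x. f x \<ge> 0"
    and int: "(\<integral>\<^sup>+x. ennreal (varpi p k T (f x)) \<partial>P) < \<infinity>"
    and \<epsilon>: "\<epsilon> > 0"
  shows "\<exists>t\<ge>R. (\<integral>\<^sup>+x. ennreal (min (f x) t) \<partial>P) < ennreal (\<epsilon> * t powr (1 - p))"
proof (rule ccontr)
  assume contr: "\<not> ?thesis"
  interpret P: finite_measure P
    by fact
  have "eventually (\<lambda>t. log_defect k t \<le> p / 2) at_top"
    using order_tendstoD(2)[OF log_defect_tendsto_0, of "p / 2" k] p
    by (auto elim: eventually_mono)
  then obtain R0 where R0: "\<And>t. t \<ge> R0 \<Longrightarrow> log_defect k t \<le> p / 2"
    by (auto simp: eventually_at_top_linorder)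
  \<comment> \<open>Beyond \<open>S\<close> the gauge is given by its formula and the logarithmic defect is at most \<open>p / 2\<close>.\<close>
  define S where "S = Max {R, T, R0}"
  have S: "S \<ge> R" "S \<ge> T" "S \<ge> R0" "S > 0"
    using thr by (auto simp: S_def admissible_threshold_def less_max_iff_disj)
  have pos: "iter_log j t > 0" if "t \<ge> S" "j \<in> {1..k}" for t j
    using thr S that unfolding admissible_threshold_def by auto
  have Lpos: "Lambda k t > 0" if "t \<ge> S" for t
    using pos[OF that] by (rule Lambda_pos)
  define C where "C = 2 / p + 1 / (1 - p)"
  have "C \<ge> 0"
    using p by (simp add: C_def)
  define B where "B = (\<integral>\<^sup>+x. ennreal C * (ennreal (varpi p k T (f x)) + ennreal (varpi p k T S)) \<partial>P)"
  have [measurable]: "varpi p k T \<in> borel_measurable borel"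
    unfolding varpi_def by measurable
  have "B = ennreal C * ((\<integral>\<^sup>+x. ennreal (varpi p k T (f x)) \<partial>P)
      + ennreal (varpi p k T S) * emeasure P (space P))"
    unfolding B_def by (simp add: nn_integral_cmult nn_integral_add)
  then have "B < \<infinity>"
    using int P.emeasure_finite[of "space P"]
    by (auto simp: ennreal_mult_less_top ennreal_add_less_top less_top[symmetric] ennreal_mult_eq_top_iff)
  have bound: "ennreal (\<epsilon> * (iter_log (Suc k) U - iter_log (Suc k) S)) \<le> B" if "U \<ge> S" for U
  proof -
    interpret pair_sigma_finite P lborel ..
    define g where "g x t = ennreal (t powr (p - 2) * min (f x) t / Lambda k t) * indicator {S..U} t" for x t
    have "ennreal (\<epsilon> * (iter_log (Suc k) U - iter_log (Suc k) S))
        = (\<integral>\<^sup>+t. ennreal (\<epsilon> * (1 / (t * Lambda k t))) * indicator {S..U} t \<partial>lborel)"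
    proof -
      have "(\<integral>\<^sup>+t. ennreal (\<epsilon> * (1 / (t * Lambda k t))) * indicator {S..U} t \<partial>lborel)
          = \<epsilon> * iter_log (Suc k) U - \<epsilon> * iter_log (Suc k) S"
      proof (rule nn_integral_FTC_Icc)
        fix t assume t: "t \<in> {S..U}"
        show "((\<lambda>t. \<epsilon> * iter_log (Suc k) t) has_real_derivative \<epsilon> * (1 / (t * Lambda k t))) (at t)"
          by (rule DERIV_cmult[OF has_derivative_iter_log])
            (use t S pos in auto)
        show "0 \<le> \<epsilon> * (1 / (t * Lambda k t))"
          using t S Lpos[of t] \<epsilon> by auto
      qed (use that in auto)
      then show ?thesis
        by (simp add: right_diff_distrib)
    qed
    also have "\<dots> \<le> (\<integral>\<^sup>+t. (\<integral>\<^sup>+x. g x t \<partial>P) \<partial>lborel)"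
    proof (rule nn_integral_mono)
      fix t :: real
      show "ennreal (\<epsilon> * (1 / (t * Lambda k t))) * indicator {S..U} t \<le> (\<integral>\<^sup>+x. g x t \<partial>P)"
      proof (cases "t \<in> {S..U}")
        case True
        then have t: "t \<ge> S" "t > 0" "t \<ge> R"
          using S by auto
        have "\<epsilon> * (1 / (t * Lambda k t)) = (t powr (p - 2) / Lambda k t) * (\<epsilon> * t powr (1 - p))"
        proof -
          have "t powr (p - 2) * t powr (1 - p) = t powr (-1)"
            by (simp add: powr_add[symmetric])
          also have "\<dots> = 1 / t"
            using t by (simp add: powr_minus_divide)
          finally have "1 / (t * Lambda k t) = (t powr (p - 2) * t powr (1 - p)) / Lambda k t"
            by simp
          then show ?thesis
            by simp
        qed
        then have "ennreal (\<epsilon> * (1 / (t * Lambda k t)))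
            = ennreal (t powr (p - 2) / Lambda k t) * ennreal (\<epsilon> * t powr (1 - p))"
          using Lpos[OF t(1)] \<epsilon> by (simp only:) (rule ennreal_mult; simp)
        also have "\<dots> \<le> ennreal (t powr (p - 2) / Lambda k t) * (\<integral>\<^sup>+x. ennreal (min (f x) t) \<partial>P)"
          using contr t by (intro mult_left_mono) (auto simp: not_less)
        also have "\<dots> = (\<integral>\<^sup>+x. ennreal (t powr (p - 2) / Lambda k t) * ennreal (min (f x) t) \<partial>P)"
          by (rule nn_integral_cmult[symmetric]) auto
        also have "\<dots> = (\<integral>\<^sup>+x. g x t \<partial>P)"
          using True t Lpos[OF t(1)] f_nonneg
          by (intro nn_integral_cong) (simp add: g_def ennreal_mult[symmetric])
        finally show ?thesis
          using True by simp
      qed simp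
    qed
    also have "\<dots> = (\<integral>\<^sup>+x. (\<integral>\<^sup>+t. g x t \<partial>lborel) \<partial>P)"
    proof -
      have "(\<lambda>(x, t). g x t) \<in> borel_measurable (P \<Otimes>\<^sub>M lborel)"
        unfolding g_def by measurable
      from Fubini[OF this] show ?thesis
        by simp
    qed
    also have "\<dots> \<le> B"
      unfolding B_def
    proof (rule nn_integral_mono)
      fix x
      define w where "w = max (f x) S"
      have "(\<integral>\<^sup>+t. g x t \<partial>lborel) \<le> ennreal (C * (w powr p / Lambda k w))"
        unfolding g_def C_def
        by (rule weighted_integral_truncation_le) (use p S pos R0 in \<open>auto simp: w_def\<close>)
      also have "w powr p / Lambda k w \<le> varpi p k T (f x) + varpi p k T S"
        using S varpi_nonneg[OF thr, of "f x"] varpi_nonneg[OF thr, of S]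
        by (auto simp: w_def max_def varpi_def)
      then have "ennreal (C * (w powr p / Lambda k w)) \<le> ennreal (C * (varpi p k T (f x) + varpi p k T S))"
        using \<open>C \<ge> 0\<close> by (intro ennreal_leI mult_left_mono) auto
      also have "\<dots> = ennreal C * (ennreal (varpi p k T (f x)) + ennreal (varpi p k T S))"
        using \<open>C \<ge> 0\<close> varpi_nonneg[OF thr] by (simp add: ennreal_mult ennreal_plus)
      finally show "(\<integral>\<^sup>+t. g x t \<partial>lborel) \<le> ennreal C * (ennreal (varpi p k T (f x)) + ennreal (varpi p k T S))" .
    qed
    finally show ?thesis .
  qed
  have "eventually (\<lambda>U. iter_log (Suc k) U > iter_log (Suc k) S + (enn2real B + 1) / \<epsilon>) at_top"
    using filterlim_iter_log by (auto simp: filterlim_at_top_dense)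
  then have "eventually (\<lambda>U. U \<ge> S \<and> iter_log (Suc k) U > iter_log (Suc k) S + (enn2real B + 1) / \<epsilon>) at_top"
    by (intro eventually_conj eventually_ge_at_top)
  from eventually_happens'[OF trivial_limit_at_top_linorder this]
  obtain U where U: "U \<ge> S" "iter_log (Suc k) U > iter_log (Suc k) S + (enn2real B + 1) / \<epsilon>"
    by blast
  have "enn2real B + 1 \<le> \<epsilon> * (iter_log (Suc k) U - iter_log (Suc k) S)"
    using U(2) \<epsilon> by (simp add: field_simps)
  then have "ennreal (enn2real B + 1) \<le> B"
    using bound[OF U(1)] by (meson ennreal_leI order_trans)
  then show False
    using \<open>B < \<infinity>\<close> by (cases B rule: ennreal_cases) (auto simp: ennreal_le_iff)
qed

section \<open>Visits of orbits of measure-preserving actions\<close>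

lemma measure_preserving_actionD:
  assumes "measure_preserving_action M a"
  shows "a g \<in> measurable M M"
    and "x \<in> space M \<Longrightarrow> a 0 x = x"
    and "x \<in> space M \<Longrightarrow> a (g + h) x = a g (a h x)"
    and "x \<in> space M \<Longrightarrow> a g x \<in> space M"
    and "distr M M (a g) = M"
  using assms measurable_space[of "a g" M M x]
  unfolding measure_preserving_action_def measurable_action_def by auto

lemma AE_translate:
  assumes "measure_preserving_action M a" and "AE x in M. Q x"
  shows "AE x in M. Q (a g x)"
proof (rule AE_distrD[where M' = M])
  show "a g \<in> measurable M M"
    by (rule measure_preserving_actionD[OF assms(1)])
  show "AE x in distr M M (a g). Q x"
    using assms(2) by (simp only: measure_preserving_actionD(5)[OF assms(1)])
qed

text \<open>
  Moving along an orbit only translates the set of visiting times, so finiteness and cardinality of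
  that set depend on the orbit alone.
\<close>

lemma visits_translate:
  fixes a :: "'g::{group_add,countable} \<Rightarrow> 'x \<Rightarrow> 'x"
  assumes act: "measure_preserving_action M a" and x: "x \<in> space M"
  shows "{g. a g x \<in> Y} \<subseteq> (\<lambda>g. g + g0) ` {g. a g (a g0 x) \<in> Y}"
proof
  fix g assume "g \<in> {g. a g x \<in> Y}"
  then have "g - g0 \<in> {g. a g (a g0 x) \<in> Y}"
    using x by (simp flip: measure_preserving_actionD(3)[OF act])
  then show "g \<in> (\<lambda>g. g + g0) ` {g. a g (a g0 x) \<in> Y}"
    by (metis diff_add_cancel image_eqI)
qed

lemma unique_return_if_free:
  fixes a :: "'g::{group_add,countable} \<Rightarrow> 'x \<Rightarrow> 'x"
  assumes act: "measure_preserving_action M a" and x: "x \<in> space M"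
    and free: "\<And>g. g \<noteq> 0 \<Longrightarrow> a g x \<noteq> x"
    and card: "card (F \<inter> orbit a x) = 1"
  shows "\<exists>!g. a g x \<in> F"
proof -
  note [simp] = measure_preserving_actionD[OF act]
  obtain y where y: "F \<inter> orbit a x = {y}"
    using card by (auto simp: card_1_singleton_iff)
  then have "y \<in> F \<inter> orbit a x"
    by simp
  then obtain g where g: "a g x \<in> F"
    by (auto simp: orbit_def)
  show ?thesis
  proof (rule ex1I[of "\<lambda>g. a g x \<in> F", OF g])
    fix g' assume "a g' x \<in> F"
    moreover have "a h x = y" if "a h x \<in> F" for h
    proof -
      have "a h x \<in> F \<inter> orbit a x"
        using that by (simp add: orbit_def)
      then show ?thesis
        by (simp add: y)
    qed
    ultimately have "a g' x = a g x"
      using g by blast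
    then have "a (- g) (a g' x) = a (- g) (a g x)"
      by simp
    then have "a (- g + g') x = x"
      using x by (simp flip: measure_preserving_actionD(3)[OF act])
    then have "- g + g' = 0"
      using free by blast
    then show "g' = g"
      by (metis add.inverse_inverse add.inverse_unique)
  qed
qed

lemma AE_unique_return:
  fixes a :: "'g::{group_add,countable} \<Rightarrow> 'x \<Rightarrow> 'x"
  assumes "measure_preserving_action M a" "essentially_free M a" "fundamental_domain M a F"
  shows "AE x in M. \<exists>!g. a g x \<in> F"
proof -
  have "AE x in M. \<forall>g. g \<noteq> 0 \<longrightarrow> a g x \<noteq> x" "AE x in M. card (F \<inter> orbit a x) = 1"
    using assms by (auto simp: essentially_free_def fundamental_domain_def)
  then show ?thesis
    using AE_space
  proof eventually_elim
    case (elim x)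
    then show ?case
      using unique_return_if_free[OF assms(1), of x F] by blast
  qed
qed

text \<open>
  Mass transport: every point of \<open>F\<close> sends one unit of mass to each point of \<open>Y\<close> in its orbit.
  A point of \<open>Y\<close> receives exactly one unit, as its orbit meets \<open>F\<close> once. Hence the number of visits
  to \<open>Y\<close> has integral \<open>\<mu>(Y) < \<infinity>\<close> over \<open>F\<close>, so it is finite almost everywhere on \<open>F\<close>, and then
  almost everywhere by invariance along orbits.
\<close>

lemma AE_finite_visits:
  fixes a :: "'g::{group_add,countable} \<Rightarrow> 'x \<Rightarrow> 'x"
  assumes act: "measure_preserving_action M a" and free: "essentially_free M a"
    and F: "fundamental_domain M a F"
    and Y [measurable]: "Y \<in> sets M" and Y_fin: "emeasure M Y < \<infinity>"
  shows "AE x in M. finite {g. a g x \<in> Y}"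
proof -
  note actD = measure_preserving_actionD[OF act]
  note [measurable] = actD(1)
  have [measurable]: "F \<in> sets M"
    using F by (simp add: fundamental_domain_def)
  define visits where "visits x = (\<integral>\<^sup>+g. indicator Y (a g x) * indicator F x \<partial>count_space UNIV)" for x
  interpret count: sigma_finite_measure "count_space (UNIV :: 'g set)"
    by (rule sigma_finite_measure_count_space)
  have visits_measurable [measurable]: "visits \<in> borel_measurable M"
    unfolding visits_def
  proof (rule count.borel_measurable_nn_integral)
    have "(\<lambda>z. indicator Y (a (snd z) (fst z)) * indicator F (fst z) :: ennreal)
        \<in> borel_measurable (M \<Otimes>\<^sub>M count_space UNIV)"
      by (rule measurable_compose_countable[where g = snd]) measurable
    then show "(\<lambda>(x, g). indicator Y (a g x) * indicator F x :: ennreal)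
        \<in> borel_measurable (M \<Otimes>\<^sub>M count_space UNIV)"
      by (simp add: split_beta)
  qed
  have "(\<integral>\<^sup>+x. visits x \<partial>M) = (\<integral>\<^sup>+g. (\<integral>\<^sup>+x. indicator Y (a g x) * indicator F x \<partial>M) \<partial>count_space UNIV)"
    unfolding visits_def by (rule nn_integral_count_space_nn_integral) auto
  also have "\<dots> = (\<integral>\<^sup>+g. (\<integral>\<^sup>+x. indicator Y x * indicator F (a (- g) x) \<partial>M) \<partial>count_space UNIV)"
  proof (rule nn_integral_cong)
    fix g
    have "(\<integral>\<^sup>+x. indicator Y x * indicator F (a (- g) x) \<partial>M)
        = (\<integral>\<^sup>+x. indicator Y x * indicator F (a (- g) x) \<partial>distr M M (a g))"
      by (simp add: actD(5))
    also have "\<dots> = (\<integral>\<^sup>+x. indicator Y (a g x) * indicator F (a (- g) (a g x)) \<partial>M)"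
      by (rule nn_integral_distr) measurable
    also have "\<dots> = (\<integral>\<^sup>+x. indicator Y (a g x) * indicator F x \<partial>M)"
      by (intro nn_integral_cong) (simp flip: actD(3) add: actD(2))
    finally show "(\<integral>\<^sup>+x. indicator Y (a g x) * indicator F x \<partial>M)
        = (\<integral>\<^sup>+x. indicator Y x * indicator F (a (- g) x) \<partial>M)" ..
  qed
  also have "\<dots> = (\<integral>\<^sup>+x. (\<integral>\<^sup>+g. indicator Y x * indicator F (a (- g) x) \<partial>count_space UNIV) \<partial>M)"
    by (rule nn_integral_count_space_nn_integral[symmetric]) auto
  also have "\<dots> = (\<integral>\<^sup>+x. indicator Y x \<partial>M)"
  proof (rule nn_integral_cong_AE)
    show "AE x in M. (\<integral>\<^sup>+g. indicator Y x * indicator F (a (- g) x) \<partial>count_space UNIV) = indicator Y x"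
      using AE_unique_return[OF act free F]
    proof eventually_elim
      case (elim x)
      then obtain g0 where g0: "a g x \<in> F \<longleftrightarrow> g = g0" for g
        by metis
      have "(\<integral>\<^sup>+g. indicator Y x * indicator F (a (- g) x) \<partial>count_space UNIV)
          = (\<integral>\<^sup>+g. indicator Y x * indicator {- g0} g \<partial>count_space UNIV)"
        using g0 by (intro nn_integral_cong) (auto simp: indicator_def)
      also have "\<dots> = indicator Y x"
        by (simp add: nn_integral_cmult_indicator)
      finally show ?case .
    qed
  qed
  also have "\<dots> < \<infinity>"
    using Y_fin by simp
  finally have "AE x in M. visits x \<noteq> \<infinity>"
    by (intro nn_integral_PInf_AE visits_measurable) auto
  then have "AE x in M. x \<in> F \<longrightarrow> finite {g. a g x \<in> Y}"
  proof eventually_elim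
    case (elim x)
    have "visits x = emeasure (count_space UNIV) {g. a g x \<in> Y}" if "x \<in> F"
    proof -
      have "visits x = (\<integral>\<^sup>+g. indicator {g. a g x \<in> Y} g \<partial>count_space UNIV)"
        unfolding visits_def using that by (intro nn_integral_cong) (auto simp: indicator_def)
      then show ?thesis
        by simp
    qed
    then show ?case
      using elim by (auto simp: emeasure_count_space split: if_splits)
  qed
  then have "AE x in M. \<forall>g0. a g0 x \<in> F \<longrightarrow> finite {g. a g (a g0 x) \<in> Y}"
    by (simp only: AE_all_countable)
      (intro allI AE_translate[OF act, where Q = "\<lambda>x. x \<in> F \<longrightarrow> finite {g. a g x \<in> Y}"])
  with AE_unique_return[OF act free F] AE_space show ?thesis
  proof eventually_elim
    case (elim x)
    then obtain g0 where "finite {g. a g (a g0 x) \<in> Y}"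
      by blast
    then show ?case
      using visits_translate[OF act, of x Y g0] elim by (meson finite_imageI finite_subset)
  qed
qed

lemma measure_preserving_action_restrict:
  fixes a :: "'g::{group_add,countable} \<Rightarrow> 'x \<Rightarrow> 'x"
  assumes act: "measure_preserving_action M a" and \<Omega>: "\<Omega> \<in> sets M"
    and inv: "\<And>g x. x \<in> \<Omega> \<Longrightarrow> a g x \<in> \<Omega>"
  shows "measure_preserving_action (restrict_space M \<Omega>) a"
proof -
  note actD = measure_preserving_actionD[OF act]
  have \<Omega>_space: "x \<in> space M" if "x \<in> \<Omega>" for x
    using that sets.sets_into_space[OF \<Omega>] by auto
  have meas: "a g \<in> measurable (restrict_space M \<Omega>) (restrict_space M \<Omega>)" for g
    using inv by (intro measurable_restrict_space3 actD) auto
  have "distr (restrict_space M \<Omega>) (restrict_space M \<Omega>) (a g) = restrict_space M \<Omega>" for g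
  proof (rule measure_eqI)
    fix A assume "A \<in> sets (distr (restrict_space M \<Omega>) (restrict_space M \<Omega>) (a g))"
    then have A: "A \<in> sets (restrict_space M \<Omega>)" "A \<in> sets M" "A \<subseteq> \<Omega>"
      using \<Omega> by (auto simp: sets_restrict_space_iff)
    have sub: "a g -` A \<inter> space M \<subseteq> \<Omega>"
    proof
      fix x assume x: "x \<in> a g -` A \<inter> space M"
      then have "a (- g) (a g x) \<in> \<Omega>"
        using A inv by auto
      then show "x \<in> \<Omega>"
        using x by (simp flip: actD(3) add: actD(2))
    qed
    have "emeasure (distr (restrict_space M \<Omega>) (restrict_space M \<Omega>) (a g)) A
        = emeasure (restrict_space M \<Omega>) (a g -` A \<inter> \<Omega>)"
      using A meas \<Omega> by (subst emeasure_distr) auto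
    also have "a g -` A \<inter> \<Omega> = a g -` A \<inter> space M"
      using sub \<Omega>_space by auto
    also have "emeasure (restrict_space M \<Omega>) \<dots> = emeasure M (a g -` A \<inter> space M)"
      using \<Omega> sub by (intro emeasure_restrict_space) auto
    also have "\<dots> = emeasure (distr M M (a g)) A"
      using A by (intro emeasure_distr[symmetric] actD) auto
    also have "\<dots> = emeasure (restrict_space M \<Omega>) A"
      using A \<Omega> by (simp add: actD emeasure_restrict_space)
    finally show "emeasure (distr (restrict_space M \<Omega>) (restrict_space M \<Omega>) (a g)) A
        = emeasure (restrict_space M \<Omega>) A" .
  qed simp
  then show ?thesis
    using meas actD \<Omega> \<Omega>_space
    unfolding measure_preserving_action_def measurable_action_def by simp
qed

section \<open>Couplings without exceptional null sets\<close>

lemma nn_integral_count_space_single: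
  assumes "\<And>h. F h \<noteq> 0 \<Longrightarrow> h = h0"
  shows "(\<integral>\<^sup>+h. F h \<partial>count_space UNIV) = F h0"
proof -
  have "(\<integral>\<^sup>+h. F h \<partial>count_space UNIV) = (\<integral>\<^sup>+h. F h * indicator {h0} h \<partial>count_space UNIV)"
    using assms by (intro nn_integral_cong) (auto split: split_indicator)
  also have "\<dots> = F h0"
    by (simp add: nn_integral_count_space_indicator[symmetric] nn_integral_count_space_finite)
  finally show ?thesis .
qed

text \<open>
  \<open>Y\<close> stands for the fundamental domain of \<open>H\<close> on which \<open>G\<close> acts. A fundamental domain of \<open>G\<close> enters
  through its consequence that every \<open>G\<close>-orbit visits \<open>Y\<close> finitely often.
\<close>

locale strict_coupling =
  fixes M :: "'x measure"
    and a :: "'g::{group_add,countable} \<Rightarrow> 'x \<Rightarrow> 'x"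
    and b :: "'h::{group_add,countable} \<Rightarrow> 'x \<Rightarrow> 'x"
    and Y :: "'x set"
  assumes a: "measure_preserving_action M a"
    and b: "measure_preserving_action M b"
    and commute: "x \<in> space M \<Longrightarrow> b h (a g x) = a g (b h x)"
    and Y [measurable]: "Y \<in> sets M"
    and unique_return: "x \<in> space M \<Longrightarrow> \<exists>!h. b h x \<in> Y"
    and finite_visits: "x \<in> space M \<Longrightarrow> finite {g. a g x \<in> Y}"
    and finite_Y: "emeasure M Y < \<infinity>"
    and Y_nonnull: "emeasure M Y \<noteq> 0"
begin

lemma a_measurable [measurable]: "a g \<in> measurable M M"
  and b_measurable [measurable]: "b h \<in> measurable M M"
  and a_0: "x \<in> space M \<Longrightarrow> a 0 x = x"
  and b_0: "x \<in> space M \<Longrightarrow> b 0 x = x"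
  and a_add: "x \<in> space M \<Longrightarrow> a (g + g') x = a g (a g' x)"
  and b_add: "x \<in> space M \<Longrightarrow> b (h + h') x = b h (b h' x)"
  and distr_a: "distr M M (a g) = M"
  and distr_b: "distr M M (b h) = M"
  using a b unfolding measure_preserving_action_def measurable_action_def by auto

lemma a_space [simp]: "x \<in> space M \<Longrightarrow> a g x \<in> space M"
  and b_space [simp]: "x \<in> space M \<Longrightarrow> b h x \<in> space M"
  using measurable_space[OF a_measurable] measurable_space[OF b_measurable] by auto

lemma Y_space: "x \<in> Y \<Longrightarrow> x \<in> space M"
  using sets.sets_into_space[OF Y] by auto

definition \<kappa> :: "'g \<Rightarrow> 'x \<Rightarrow> 'h" where
  "\<kappa> g x = (THE h. b h (a g x) \<in> Y)"

definition act :: "'g \<Rightarrow> 'x \<Rightarrow> 'x" where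
  "act g x = b (\<kappa> g x) (a g x)"

lemma \<kappa>_eq_iff: "x \<in> space M \<Longrightarrow> \<kappa> g x = h \<longleftrightarrow> b h (a g x) \<in> Y"
  unfolding \<kappa>_def using unique_return[OF a_space[of x g]] theI'[of "\<lambda>h. b h (a g x) \<in> Y"]
  by (metis (mono_tags, lifting))

lemma act_in_Y: "x \<in> space M \<Longrightarrow> act g x \<in> Y"
  unfolding act_def using \<kappa>_eq_iff by blast

lemma \<kappa>_add:
  assumes x: "x \<in> space M"
  shows "\<kappa> (g + g') x = \<kappa> g (act g' x) + \<kappa> g' x"
proof -
  have y: "act g' x \<in> space M"
    using act_in_Y[OF x] by (rule Y_space)
  have "b (\<kappa> g (act g' x) + \<kappa> g' x) (a (g + g') x) = b (\<kappa> g (act g' x)) (a g (act g' x))"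
    using x by (simp add: a_add b_add act_def commute)
  also have "\<dots> \<in> Y"
    using act_in_Y[OF y, of g] by (simp add: act_def)
  finally show ?thesis
    using \<kappa>_eq_iff[OF x] by blast
qed

definition P :: "'x measure" where
  "P = restrict_space M Y"

lemma space_P [simp]: "space P = Y"
  unfolding P_def using Y by simp

lemma sets_P: "A \<in> sets P \<longleftrightarrow> A \<in> sets M \<and> A \<subseteq> Y"
  unfolding P_def using Y by (auto simp: sets_restrict_space_iff)

lemma emeasure_P: "A \<subseteq> Y \<Longrightarrow> emeasure P A = emeasure M A"
  unfolding P_def using Y by (intro emeasure_restrict_space) auto

lemma nn_integral_P: "(\<integral>\<^sup>+x. f x \<partial>P) = (\<integral>\<^sup>+x. f x * indicator Y x \<partial>M)"
  unfolding P_def using Y by (intro nn_integral_restrict_space) auto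

sublocale P: finite_measure P
  by standard (use finite_Y in \<open>simp add: emeasure_P less_top\<close>)

lemma \<kappa>_measurable [measurable]: "\<kappa> g \<in> measurable P (count_space UNIV)"
proof -
  have "\<kappa> g -` {h} \<inter> space P = Y \<inter> ((\<lambda>x. b h (a g x)) -` Y \<inter> space M)" for h
    using \<kappa>_eq_iff[of _ g h] Y_space by (auto simp del: a_space b_space)
  moreover have "(\<lambda>x. b h (a g x)) -` Y \<inter> space M \<in> sets M" for h
    by measurable
  ultimately show ?thesis
    using Y by (auto simp: measurable_count_space_eq2_countable sets_P)
qed

lemma act_measurable [measurable]: "act g \<in> measurable P P"
proof -
  have *: "(\<lambda>x. b h (a g x)) \<in> measurable P M" for h
    unfolding P_def by (intro measurable_restrict_space1) measurable
  have "(\<lambda>x. b (\<kappa> g x) (a g x)) \<in> measurable P M"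
    by (rule measurable_compose_countable[OF * \<kappa>_measurable])
  moreover have "act g = (\<lambda>x. b (\<kappa> g x) (a g x))"
    by (rule ext) (simp add: act_def)
  ultimately have "act g \<in> measurable P M"
    by simp
  then have "act g \<in> measurable P (restrict_space M Y)"
    using act_in_Y Y_space by (intro measurable_restrict_space2) auto
  then show ?thesis
    by (simp add: P_def)
qed

lemma nn_integral_a: "f \<in> borel_measurable M \<Longrightarrow> (\<integral>\<^sup>+x. f (a g x) \<partial>M) = (\<integral>\<^sup>+x. f x \<partial>M)"
  using nn_integral_distr[OF a_measurable, of f g] by (simp add: distr_a)

lemma nn_integral_b: "f \<in> borel_measurable M \<Longrightarrow> (\<integral>\<^sup>+x. f (b h x) \<partial>M) = (\<integral>\<^sup>+x. f x \<partial>M)"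
  using nn_integral_distr[OF b_measurable, of f h] by (simp add: distr_b)

text \<open>
  The induced action preserves the measure: cut \<open>Y\<close> into the pieces on which \<open>\<kappa> g\<close> is constant.
  On the piece with value \<open>h\<close> the induced action agrees with the measure-preserving map \<open>b h \<circ> a g\<close>,
  and the images of the pieces partition \<open>Y\<close>, because each \<open>y\<close> comes back to \<open>Y\<close> from \<open>a (- g) y\<close>
  in exactly one way.
\<close>

lemma nn_integral_act_ambient:
  assumes f [measurable]: "f \<in> borel_measurable M"
  shows "(\<integral>\<^sup>+x. f (act g x) \<partial>P) = (\<integral>\<^sup>+x. f x \<partial>P)"
proof -
  \<comment> \<open>\<open>F\<close> describes a piece of \<open>Y\<close> seen from its points, \<open>F'\<close> seen from their images.\<close>
  define F where "F h x = f (b h (a g x)) * indicator Y (b h (a g x)) * indicator Y x" for h x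
  define F' where "F' h y = f y * indicator Y y * indicator Y (a (- g) (b (- h) y))" for h y
  have [measurable]: "F h \<in> borel_measurable M" "F' h \<in> borel_measurable M" for h
    unfolding F_def F'_def by measurable
  have "(\<integral>\<^sup>+x. f (act g x) \<partial>P) = (\<integral>\<^sup>+x. (\<integral>\<^sup>+h. F h x \<partial>count_space UNIV) \<partial>M)"
    unfolding nn_integral_P
  proof (rule nn_integral_cong)
    fix x assume x: "x \<in> space M"
    have "(\<integral>\<^sup>+h. F h x \<partial>count_space UNIV) = F (\<kappa> g x) x"
      using x by (intro nn_integral_count_space_single)
        (auto simp: F_def \<kappa>_eq_iff[OF x, symmetric] indicator_def split: if_splits)
    also have "\<dots> = f (act g x) * indicator Y x"
      using act_in_Y[OF x, of g] by (simp add: F_def act_def)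
    finally show "f (act g x) * indicator Y x = (\<integral>\<^sup>+h. F h x \<partial>count_space UNIV)"
      by simp
  qed
  also have "\<dots> = (\<integral>\<^sup>+h. (\<integral>\<^sup>+x. F h x \<partial>M) \<partial>count_space UNIV)"
    by (rule nn_integral_count_space_nn_integral) auto
  also have "\<dots> = (\<integral>\<^sup>+h. (\<integral>\<^sup>+y. F' h y \<partial>M) \<partial>count_space UNIV)"
  proof (rule nn_integral_cong)
    fix h
    have "(\<integral>\<^sup>+x. F h x \<partial>M) = (\<integral>\<^sup>+x. F' h (b h (a g x)) \<partial>M)"
    proof (rule nn_integral_cong)
      fix x assume x: "x \<in> space M"
      have "b (- h) (b h (a g x)) = a g x"
        using x by (simp add: b_add[symmetric] b_0)
      then have "a (- g) (b (- h) (b h (a g x))) = x"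
        using x by (simp add: a_add[symmetric] a_0)
      then show "F h x = F' h (b h (a g x))"
        by (simp add: F_def F'_def)
    qed
    also have "\<dots> = (\<integral>\<^sup>+x. F' h (b h x) \<partial>M)"
      by (rule nn_integral_a[of "\<lambda>x. F' h (b h x)"]) measurable
    also have "\<dots> = (\<integral>\<^sup>+x. F' h x \<partial>M)"
      by (rule nn_integral_b) measurable
    finally show "(\<integral>\<^sup>+x. F h x \<partial>M) = (\<integral>\<^sup>+y. F' h y \<partial>M)" .
  qed
  also have "\<dots> = (\<integral>\<^sup>+y. (\<integral>\<^sup>+h. F' h y \<partial>count_space UNIV) \<partial>M)"
    by (rule nn_integral_count_space_nn_integral[symmetric]) auto
  also have "\<dots> = (\<integral>\<^sup>+y. f y \<partial>P)"
    unfolding nn_integral_P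
  proof (rule nn_integral_cong)
    fix y assume y: "y \<in> space M"
    have return: "a (- g) (b (- h) y) \<in> Y \<longleftrightarrow> h = - \<kappa> (- g) y" for h
      using \<kappa>_eq_iff[OF y, of "- g" "- h"] commute[OF y, of "- h" "- g"]
      by (metis minus_minus)
    have "(\<integral>\<^sup>+h. F' h y \<partial>count_space UNIV) = F' (- \<kappa> (- g) y) y"
      using return by (intro nn_integral_count_space_single) (auto simp: F'_def indicator_def split: if_splits)
    also have "\<dots> = f y * indicator Y y"
      using return[of "- \<kappa> (- g) y"] by (simp add: F'_def)
    finally show "(\<integral>\<^sup>+h. F' h y \<partial>count_space UNIV) = f y * indicator Y y" .
  qed
  finally show ?thesis .
qed

lemma distr_act: "distr P P (act g) = P"
proof (rule measure_eqI)
  fix A assume "A \<in> sets (distr P P (act g))"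
  then have A: "A \<in> sets P" "A \<in> sets M"
    by (auto simp: sets_P)
  have "emeasure (distr P P (act g)) A = (\<integral>\<^sup>+x. indicator A x \<partial>distr P P (act g))"
    using A by simp
  also have "\<dots> = (\<integral>\<^sup>+x. indicator A (act g x) \<partial>P)"
    using A by (intro nn_integral_distr) auto
  also have "\<dots> = (\<integral>\<^sup>+x. indicator A x \<partial>P)"
    using A by (intro nn_integral_act_ambient) auto
  finally show "emeasure (distr P P (act g)) A = emeasure P A"
    using A by simp
qed simp

lemma nn_integral_act:
  assumes "f \<in> borel_measurable P"
  shows "(\<integral>\<^sup>+x. f (act g x) \<partial>P) = (\<integral>\<^sup>+x. f x \<partial>P)"
  using nn_integral_distr[OF act_measurable[of g], of f] assms by (simp add: distr_act)

text \<open>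
  Truncation makes the mean finite for every element of \<open>G\<close>, although the length of the cocycle need
  not be integrable.
\<close>

definition truncated_length :: "('h \<Rightarrow> real) \<Rightarrow> real \<Rightarrow> 'g \<Rightarrow> ennreal" where
  "truncated_length \<rho> t g = (\<integral>\<^sup>+x. ennreal (min (\<rho> (\<kappa> g x)) t) \<partial>P)"

lemma truncated_length_add:
  assumes nonneg: "\<And>h. \<rho> h \<ge> 0" and subadd: "\<And>h h'. \<rho> (h + h') \<le> \<rho> h + \<rho> h'" and "t \<ge> 0"
  shows "truncated_length \<rho> t (g + g') \<le> truncated_length \<rho> t g + truncated_length \<rho> t g'"
proof -
  have meas [measurable]: "(\<lambda>x. ennreal (min (\<rho> (\<kappa> g x)) t)) \<in> borel_measurable P" for g
    by measurable
  have act_meas: "(\<lambda>x. ennreal (min (\<rho> (\<kappa> g (act g' x))) t)) \<in> borel_measurable P"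
    by measurable
  have "truncated_length \<rho> t (g + g')
      \<le> (\<integral>\<^sup>+x. ennreal (min (\<rho> (\<kappa> g (act g' x))) t) + ennreal (min (\<rho> (\<kappa> g' x)) t) \<partial>P)"
    unfolding truncated_length_def
  proof (rule nn_integral_mono)
    fix x assume "x \<in> space P"
    then have "\<rho> (\<kappa> (g + g') x) \<le> \<rho> (\<kappa> g (act g' x)) + \<rho> (\<kappa> g' x)"
      using \<kappa>_add[OF Y_space, of x g g'] subadd by simp
    then have "min (\<rho> (\<kappa> (g + g') x)) t \<le> min (\<rho> (\<kappa> g (act g' x))) t + min (\<rho> (\<kappa> g' x)) t"
      using nonneg[of "\<kappa> g (act g' x)"] nonneg[of "\<kappa> g' x"] \<open>t \<ge> 0\<close> by linarith
    then have "ennreal (min (\<rho> (\<kappa> (g + g') x)) t)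
        \<le> ennreal (min (\<rho> (\<kappa> g (act g' x))) t + min (\<rho> (\<kappa> g' x)) t)"
      by (rule ennreal_leI)
    also have "\<dots> = ennreal (min (\<rho> (\<kappa> g (act g' x))) t) + ennreal (min (\<rho> (\<kappa> g' x)) t)"
      using nonneg \<open>t \<ge> 0\<close> by (intro ennreal_plus) auto
    finally show "ennreal (min (\<rho> (\<kappa> (g + g') x)) t)
        \<le> ennreal (min (\<rho> (\<kappa> g (act g' x))) t) + ennreal (min (\<rho> (\<kappa> g' x)) t)" .
  qed
  also have "\<dots> = (\<integral>\<^sup>+x. ennreal (min (\<rho> (\<kappa> g (act g' x))) t) \<partial>P) + truncated_length \<rho> t g'"
    unfolding truncated_length_def by (rule nn_integral_add[OF act_meas meas])
  also have "(\<integral>\<^sup>+x. ennreal (min (\<rho> (\<kappa> g (act g' x))) t) \<partial>P) = truncated_length \<rho> t g"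
    unfolding truncated_length_def by (rule nn_integral_act[OF meas])
  finally show ?thesis .
qed

lemma truncated_length_0:
  assumes "\<rho> 0 = 0" "t \<ge> 0"
  shows "truncated_length \<rho> t 0 = 0"
proof -
  have "\<kappa> 0 x = 0" if "x \<in> Y" for x
    using that Y_space[OF that] by (simp add: \<kappa>_eq_iff a_0 b_0)
  then have "truncated_length \<rho> t 0 = (\<integral>\<^sup>+x. 0 \<partial>P)"
    unfolding truncated_length_def using assms by (intro nn_integral_cong) auto
  then show ?thesis
    by simp
qed

lemma emeasure_long_le:
  assumes "t \<ge> 0"
  shows "ennreal t * emeasure P {x \<in> Y. t \<le> \<rho> (\<kappa> g x)} \<le> truncated_length \<rho> t g"
proof -
  have [measurable]: "{x \<in> space P. t \<le> \<rho> (\<kappa> g x)} \<in> sets P"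
    by measurable
  have "ennreal t * emeasure P {x \<in> space P. t \<le> \<rho> (\<kappa> g x)}
      = (\<integral>\<^sup>+x. ennreal t * indicator {x \<in> space P. t \<le> \<rho> (\<kappa> g x)} x \<partial>P)"
    by (rule nn_integral_cmult_indicator[symmetric]) measurable
  also have "\<dots> \<le> truncated_length \<rho> t g"
    unfolding truncated_length_def
    by (intro nn_integral_mono) (auto split: split_indicator intro!: ennreal_leI)
  finally show ?thesis
    by simp
qed

text \<open>
  The number of visits need not be square-integrable, so the mean over \<open>Y\<close> of the number of \<open>g\<close> with a
  prescribed value of the cocycle may be infinite. Restricting to points with boundedly many visits
  makes the count uniform and loses only part of \<open>Y\<close>.
\<close>

definition few_visits :: "nat \<Rightarrow> 'x set" where
  "few_visits L = {x \<in> Y. card {g. a g x \<in> Y} \<le> L}"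

lemma few_visits_measurable [measurable]: "few_visits L \<in> sets P"
proof -
  have "few_visits L = Y - (\<Union>F\<in>{F. finite F \<and> card F = Suc L}. \<Inter>g\<in>F. (a g -` Y \<inter> space M))"
  proof (intro equalityI subsetI)
    fix x assume x: "x \<in> few_visits L"
    have False if "finite F" "card F = Suc L" "\<forall>g\<in>F. a g x \<in> Y" for F
    proof -
      have "card F \<le> card {g. a g x \<in> Y}"
        using that x Y_space finite_visits by (intro card_mono) (auto simp: few_visits_def)
      then show False
        using that x by (simp add: few_visits_def)
    qed
    then show "x \<in> Y - (\<Union>F\<in>{F. finite F \<and> card F = Suc L}. \<Inter>g\<in>F. (a g -` Y \<inter> space M))"
      using x by (auto simp: few_visits_def)
  next
    fix x assume x: "x \<in> Y - (\<Union>F\<in>{F. finite F \<and> card F = Suc L}. \<Inter>g\<in>F. (a g -` Y \<inter> space M))"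
    have "card {g. a g x \<in> Y} \<le> L"
    proof (rule ccontr)
      assume "\<not> ?thesis"
      then obtain F where "F \<subseteq> {g. a g x \<in> Y}" "card F = Suc L"
        using obtain_subset_with_card_n[of "Suc L" "{g. a g x \<in> Y}"] by auto
      moreover from this have "finite F"
        by (intro card_ge_0_finite) auto
      ultimately show False
        using x Y_space by blast
    qed
    then show "x \<in> few_visits L"
      using x by (simp add: few_visits_def)
  qed
  \<comment> \<open>A union over finite subsets of the countable group \<open>G\<close>.\<close>
  moreover have "(\<Union>F\<in>{F. finite F \<and> card F = Suc L}. \<Inter>g\<in>F. (a g -` Y \<inter> space M)) \<in> sets M"
  proof (rule sets.countable_UN'')
    show "countable {F :: 'g set. finite F \<and> card F = Suc L}"
      by (rule countable_subset[OF _ countable_Collect_finite]) auto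
    show "(\<Inter>g\<in>F. (a g -` Y \<inter> space M)) \<in> sets M" if "F \<in> {F. finite F \<and> card F = Suc L}" for F
      using that by (intro sets.finite_INT) (auto intro: measurable_sets[OF a_measurable Y])
  qed
  ultimately show ?thesis
    using Y by (auto simp: sets_P)
qed

lemma few_visits_nonnull: "\<exists>L. emeasure P (few_visits L) \<noteq> 0"
proof (rule ccontr)
  assume "\<not> ?thesis"
  then have "emeasure P (\<Union>L. few_visits L) = 0"
    by (intro emeasure_UN_eq_0) auto
  moreover have "(\<Union>L. few_visits L) = Y"
    by (auto simp: few_visits_def)
  ultimately show False
    using Y_nonnull by (simp add: emeasure_P)
qed

lemma card_visits_orbit_le:
  assumes x: "x \<in> space M" and z: "a g0 x \<in> few_visits L"
  shows "finite {g. a g x \<in> Y}" "card {g. a g x \<in> Y} \<le> L"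
proof -
  have "card {g. a g x \<in> Y} \<le> card {g. a g (a g0 x) \<in> Y}"
    using visits_translate[OF a x] by (rule surj_card_le[OF finite_visits[OF a_space[OF x]]])
  then show "card {g. a g x \<in> Y} \<le> L"
    using z by (simp add: few_visits_def)
qed (rule finite_visits[OF x])

text \<open>
  If \<open>\<kappa> g x = h\<close>, then \<open>act g x = a g (b h x)\<close> lies in the \<open>G\<close>-orbit of \<open>b h x\<close>. So for fixed \<open>h\<close> the
  \<open>g\<close> counted here are visiting times of a single orbit, one that contains a point of
  \<open>few_visits L\<close>: there are at most \<open>L\<close> of them.
\<close>

lemma card_short_le:
  assumes x: "x \<in> space M" and S: "finite S"
  shows "card {g \<in> B. \<kappa> g x \<in> S \<and> act g x \<in> few_visits L} \<le> L * card S"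
proof -
  define D where "D h = {g. \<kappa> g x = h \<and> act g x \<in> few_visits L}" for h
  have D: "finite (D h) \<and> card (D h) \<le> L" for h
  proof (cases "D h = {}")
    case False
    then obtain g0 where g0: "\<kappa> g0 x = h" "act g0 x \<in> few_visits L"
      by (auto simp: D_def)
    have "a g0 (b h x) \<in> few_visits L"
      using g0 commute[OF x, of h g0] by (simp add: act_def)
    note V = card_visits_orbit_le[OF b_space[OF x] this]
    have sub: "D h \<subseteq> {g. a g (b h x) \<in> Y}"
    proof
      fix g assume "g \<in> D h"
      then have "b h (a g x) \<in> Y"
        using act_in_Y[OF x, of g] by (auto simp: D_def act_def)
      then show "g \<in> {g. a g (b h x) \<in> Y}"
        by (simp add: commute[OF x])
    qed
    show ?thesis
      using finite_subset[OF sub V(1)] card_mono[OF V(1) sub] V(2) by auto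
  qed simp
  have "card {g \<in> B. \<kappa> g x \<in> S \<and> act g x \<in> few_visits L} \<le> card (\<Union>h\<in>S. D h)"
    using S D by (intro card_mono finite_UN_I) (auto simp: D_def)
  also have "\<dots> \<le> (\<Sum>h\<in>S. card (D h))"
    by (rule card_UN_le[OF S])
  also have "\<dots> \<le> (\<Sum>h\<in>S. L)"
    using D by (intro sum_mono) auto
  finally show ?thesis
    by (simp add: mult.commute)
qed

text \<open>
  For each \<open>g\<close>, the points that \<open>act g\<close> sends into \<open>few_visits L\<close> have the measure of \<open>few_visits L\<close>.
  Those among them with \<open>\<kappa> g x \<in> S\<close> are controlled by the pointwise count after summing over \<open>g\<close>;
  the others are the error term on the right.
\<close>

lemma counting_inequality:
  assumes B: "finite B" and S: "finite S"
  shows "of_nat (card B) * emeasure P (few_visits L)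
    \<le> of_nat (L * card S) * emeasure P Y + (\<Sum>g\<in>B. emeasure P {x \<in> Y. \<kappa> g x \<notin> S})"
proof -
  define E where "E g = {x \<in> space P. \<kappa> g x \<in> S \<and> act g x \<in> few_visits L}" for g
  have E_sets [measurable]: "E g \<in> sets P" for g
    unfolding E_def by measurable
  have long_sets: "{x \<in> space P. \<kappa> g x \<notin> S} \<in> sets P" for g
    by measurable
  have one: "emeasure P (few_visits L) \<le> emeasure P (E g) + emeasure P {x \<in> space P. \<kappa> g x \<notin> S}" for g
  proof -
    have "emeasure P (few_visits L) = emeasure (distr P P (act g)) (few_visits L)"
      by (simp add: distr_act)
    also have "\<dots> = emeasure P (act g -` few_visits L \<inter> space P)"
      by (rule emeasure_distr) measurable
    also have "\<dots> \<le> emeasure P (E g \<union> {x \<in> space P. \<kappa> g x \<notin> S})"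
      by (intro emeasure_mono sets.Un E_sets long_sets) (auto simp: E_def)
    also have "\<dots> \<le> emeasure P (E g) + emeasure P {x \<in> space P. \<kappa> g x \<notin> S}"
      by (rule emeasure_subadditive[OF E_sets long_sets])
    finally show ?thesis .
  qed
  have "(\<Sum>g\<in>B. emeasure P (E g)) = (\<integral>\<^sup>+x. (\<Sum>g\<in>B. indicator (E g) x) \<partial>P)"
    by (subst nn_integral_sum) auto
  also have "\<dots> \<le> (\<integral>\<^sup>+x. of_nat (L * card S) \<partial>P)"
  proof (rule nn_integral_mono)
    fix x assume x: "x \<in> space P"
    have "(\<Sum>g\<in>B. indicator (E g) x :: ennreal)
        = of_nat (card {g \<in> B. \<kappa> g x \<in> S \<and> act g x \<in> few_visits L})"
      using x B by (simp add: E_def indicator_def sum.If_cases Int_def)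
    also have "\<dots> \<le> of_nat (L * card S)"
      using card_short_le[OF Y_space S, of x B L] x by (intro of_nat_mono) auto
    finally show "(\<Sum>g\<in>B. indicator (E g) x :: ennreal) \<le> of_nat (L * card S)" .
  qed
  finally have E: "(\<Sum>g\<in>B. emeasure P (E g)) \<le> of_nat (L * card S) * emeasure P Y"
    by simp
  have "of_nat (card B) * emeasure P (few_visits L) = (\<Sum>g\<in>B. emeasure P (few_visits L))"
    by simp
  also have "\<dots> \<le> (\<Sum>g\<in>B. emeasure P (E g) + emeasure P {x \<in> space P. \<kappa> g x \<notin> S})"
    by (intro sum_mono one)
  also have "\<dots> \<le> of_nat (L * card S) * emeasure P Y + (\<Sum>g\<in>B. emeasure P {x \<in> Y. \<kappa> g x \<notin> S})"
    using E by (simp add: sum.distrib add_right_mono)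
  finally show ?thesis .
qed

end

section \<open>Removing the exceptional null set of a coupling\<close>

text \<open>
  Every property required of a strict coupling holds off a null set \<open>N\<close>. The points all of whose
  translates \<open>b h (a g x)\<close> avoid \<open>N\<close> form a conull set; it is invariant under both actions because
  they commute at each of its points. On it the cocycle of the coupling, defined through the induced
  action, is the unique \<open>h\<close> that brings \<open>a g x\<close> back.
\<close>

lemma me_coupling_strict:
  fixes a :: "'g::{group_add,countable} \<Rightarrow> 'x \<Rightarrow> 'x"
    and b :: "'h::{group_add,countable} \<Rightarrow> 'x \<Rightarrow> 'x"
  assumes coupling: "me_coupling M a b X\<^sub>G X\<^sub>H"
  obtains \<Omega> where "\<Omega> \<in> sets M" "AE x in M. x \<in> \<Omega>"
    "strict_coupling (restrict_space M \<Omega>) a b (X\<^sub>H \<inter> \<Omega>)"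
    "\<And>g x. x \<in> X\<^sub>H \<inter> \<Omega> \<Longrightarrow> cocycle a b X\<^sub>H g x = strict_coupling.\<kappa> a b (X\<^sub>H \<inter> \<Omega>) g x"
proof -
  have act_a: "measure_preserving_action M a" and act_b: "measure_preserving_action M b"
    and free_a: "essentially_free M a" and free_b: "essentially_free M b"
    and commute: "AE x in M. \<forall>g h. b h (a g x) = a g (b h x)"
    and dom_a: "fundamental_domain M a X\<^sub>G" and dom_b: "fundamental_domain M b X\<^sub>H"
    and X\<^sub>H_fin: "emeasure M X\<^sub>H < \<infinity>" and nonnull: "emeasure M (space M) \<noteq> 0"
    using coupling by (auto simp: me_coupling_def standard_measure_space_def)
  note aD = measure_preserving_actionD[OF act_a] and bD = measure_preserving_actionD[OF act_b]
  note [measurable] = aD(1) bD(1)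
  have X\<^sub>H [measurable]: "X\<^sub>H \<in> sets M"
    using dom_b by (simp add: fundamental_domain_def)
  define good where "good x \<longleftrightarrow> (\<forall>g h. b h (a g x) = a g (b h x)) \<and> (\<exists>!h. b h x \<in> X\<^sub>H)
      \<and> card (X\<^sub>H \<inter> orbit b x) = 1 \<and> finite {g. a g x \<in> X\<^sub>H}" for x
  have "AE x in M. good x"
    using commute AE_unique_return[OF act_b free_b dom_b] AE_finite_visits[OF act_a free_a dom_a X\<^sub>H X\<^sub>H_fin]
      dom_b by (auto simp: good_def fundamental_domain_def)
  then obtain N where N: "N \<in> null_sets M" "{x \<in> space M. \<not> good x} \<subseteq> N"
    by (auto simp: eventually_ae_filter)
  have [measurable]: "N \<in> sets M"
    using N by auto
  define \<Omega> where "\<Omega> = {x \<in> space M. \<forall>g h. b h (a g x) \<notin> N}"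
  have \<Omega> [measurable]: "\<Omega> \<in> sets M"
    unfolding \<Omega>_def by measurable
  have AE_\<Omega>: "AE x in M. x \<in> \<Omega>"
  proof -
    have "AE x in M. \<forall>g h. b h (a g x) \<notin> N"
      using AE_translate[OF act_a AE_translate[OF act_b AE_not_in[OF N(1)]]] by (simp add: AE_all_countable)
    then show ?thesis
      using AE_space by eventually_elim (simp add: \<Omega>_def)
  qed
  have good: "good x" "x \<in> space M" if "x \<in> \<Omega>" for x
  proof -
    show "x \<in> space M"
      using that by (simp add: \<Omega>_def)
    then have "b 0 (a 0 x) = x"
      by (simp add: aD(2) bD(2))
    then have "x \<notin> N"
      using that unfolding \<Omega>_def by (metis (mono_tags, lifting) mem_Collect_eq)
    then show "good x"
      using N \<open>x \<in> space M\<close> by auto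
  qed
  have inv_a: "a g x \<in> \<Omega>" if "x \<in> \<Omega>" for g x
    using that unfolding \<Omega>_def by (auto simp: aD(4) simp flip: aD(3))
  have inv_b: "b h x \<in> \<Omega>" if "x \<in> \<Omega>" for h x
  proof -
    have "a g' (b h x) = b h (a g' x)" for g'
      using good(1)[OF that] by (simp add: good_def)
    then have "b h' (a g' (b h x)) = b (h' + h) (a g' x)" for g' h'
      using good(2)[OF that] by (simp add: bD(3) aD(4))
    then show ?thesis
      using that unfolding \<Omega>_def by (auto simp: bD(4))
  qed
  have strict: "strict_coupling (restrict_space M \<Omega>) a b (X\<^sub>H \<inter> \<Omega>)"
  proof
    show "measure_preserving_action (restrict_space M \<Omega>) a"
      using act_a \<Omega> inv_a by (rule measure_preserving_action_restrict)
    show "measure_preserving_action (restrict_space M \<Omega>) b"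
      using act_b \<Omega> inv_b by (rule measure_preserving_action_restrict)
    show "X\<^sub>H \<inter> \<Omega> \<in> sets (restrict_space M \<Omega>)"
      using \<Omega> X\<^sub>H by (auto simp: sets_restrict_space_iff)
    have emeasure: "emeasure (restrict_space M \<Omega>) (X\<^sub>H \<inter> \<Omega>) = emeasure M (X\<^sub>H \<inter> \<Omega>)"
      using \<Omega> by (intro emeasure_restrict_space) auto
    have "emeasure M (X\<^sub>H \<inter> \<Omega>) \<le> emeasure M X\<^sub>H"
      by (intro emeasure_mono) auto
    then show "emeasure (restrict_space M \<Omega>) (X\<^sub>H \<inter> \<Omega>) < \<infinity>"
      using X\<^sub>H_fin emeasure by simp
    show "emeasure (restrict_space M \<Omega>) (X\<^sub>H \<inter> \<Omega>) \<noteq> 0"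
    proof
      assume "emeasure (restrict_space M \<Omega>) (X\<^sub>H \<inter> \<Omega>) = 0"
      then have "X\<^sub>H \<inter> \<Omega> \<in> null_sets M"
        using emeasure X\<^sub>H \<Omega> by (auto simp: null_sets_def)
      then have "AE x in M. \<forall>h. b h x \<notin> X\<^sub>H \<inter> \<Omega>"
        by (simp only: AE_all_countable) (intro allI AE_translate[OF act_b AE_not_in])
      with AE_\<Omega> have "AE x in M. False"
      proof eventually_elim
        case (elim x)
        then show ?case
          using good(1)[of x] inv_b[of x] by (auto simp: good_def)
      qed
      then show False
        using nonnull AE_iff_measurable[of "space M" M "\<lambda>x. False"] by simp
    qed
    fix x assume "x \<in> space (restrict_space M \<Omega>)"
    then have x: "x \<in> \<Omega>"
      using \<Omega> by simp
    show "b h (a g x) = a g (b h x)" for g h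
      using good(1)[OF x] by (simp add: good_def)
    show "\<exists>!h. b h x \<in> X\<^sub>H \<inter> \<Omega>"
      using good(1)[OF x] inv_b[OF x] by (simp add: good_def)
    show "finite {g. a g x \<in> X\<^sub>H \<inter> \<Omega>}"
      using good(1)[OF x] inv_a[OF x] by (simp add: good_def)
  qed
  have "cocycle a b X\<^sub>H g x = strict_coupling.\<kappa> a b (X\<^sub>H \<inter> \<Omega>) g x" if x: "x \<in> X\<^sub>H \<inter> \<Omega>" for g x
  proof -
    have y: "a g x \<in> \<Omega>"
      using x inv_a by simp
    then obtain y where "X\<^sub>H \<inter> orbit b (a g x) = {y}"
      using good(1)[of "a g x"] by (auto simp: good_def card_1_singleton_iff)
    then have ind: "X\<^sub>H \<inter> orbit b (a g x) = {induced_action a b X\<^sub>H g x}"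
      unfolding induced_action_def by (auto intro: theI2)
    have "b h (a g x) = induced_action a b X\<^sub>H g x \<longleftrightarrow> b h (a g x) \<in> X\<^sub>H \<inter> \<Omega>" for h
      using ind inv_b[OF y, of h] by (auto simp: orbit_def)
    then show ?thesis
      unfolding cocycle_def strict_coupling.\<kappa>_def[OF strict] by simp
  qed
  then show thesis
    using \<Omega> AE_\<Omega> strict that by blast
qed

section \<open>Lattice points and subadditive functions on a box\<close>

lemma card_vec_box:
  assumes A: "finite A"
  shows "finite {v :: 'a ^ 'n. \<forall>i. v $ i \<in> A}"
    and "card {v :: 'a ^ 'n. \<forall>i. v $ i \<in> A} = card A ^ CARD('n)"
proof -
  have eq: "{v :: 'a ^ 'n. \<forall>i. v $ i \<in> A} = vec_lambda ` (UNIV \<rightarrow>\<^sub>E A)"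
  proof (intro equalityI subsetI)
    fix v :: "'a ^ 'n" assume "v \<in> {v. \<forall>i. v $ i \<in> A}"
    then show "v \<in> vec_lambda ` (UNIV \<rightarrow>\<^sub>E A)"
      by (intro image_eqI[of _ _ "vec_nth v"]) auto
  qed auto
  have "inj_on (vec_lambda :: ('n \<Rightarrow> 'a) \<Rightarrow> 'a ^ 'n) (UNIV \<rightarrow>\<^sub>E A)"
    by (rule inj_onI) (metis vec_lambda_inverse UNIV_I)
  then show "card {v :: 'a ^ 'n. \<forall>i. v $ i \<in> A} = card A ^ CARD('n)"
    unfolding eq by (simp add: card_image card_PiE)
  show "finite {v :: 'a ^ 'n. \<forall>i. v $ i \<in> A}"
    unfolding eq using A by (intro finite_imageI finite_PiE) auto
qed

lemma int_vec_length_add: "int_vec_length (v + w) \<le> int_vec_length v + int_vec_length w"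
  unfolding int_vec_length_def sum.distrib[symmetric] by (intro sum_mono) auto

lemma int_vec_ball:
  shows "finite {v :: int ^ 'm. int_vec_length v \<le> s}"
    and "card {v :: int ^ 'm. int_vec_length v \<le> s} \<le> (2 * s + 1) ^ CARD('m)"
proof -
  have sub: "{v :: int ^ 'm. int_vec_length v \<le> s} \<subseteq> {v. \<forall>i. v $ i \<in> {- int s..int s}}"
  proof safe
    fix v :: "int ^ 'm" and i assume "int_vec_length v \<le> s"
    moreover have "nat \<bar>v $ i\<bar> \<le> int_vec_length v"
      unfolding int_vec_length_def by (rule member_le_sum) auto
    ultimately show "v $ i \<in> {- int s..int s}"
      by auto
  qed
  note box = card_vec_box[where 'n = 'm, of "{- int s..int s}"]
  show "finite {v :: int ^ 'm. int_vec_length v \<le> s}"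
    using finite_subset[OF sub] box(1) by simp
  have "card {v :: int ^ 'm. int_vec_length v \<le> s} \<le> card {v :: int ^ 'm. \<forall>i. v $ i \<in> {- int s..int s}}"
    using box(1) by (intro card_mono sub) simp
  also have "\<dots> = (2 * s + 1) ^ CARD('m)"
  proof -
    have "card {- int s..int s} = 2 * s + 1"
      unfolding card_atLeastAtMost_int by linarith
    then show ?thesis
      using box(2) by simp
  qed
  finally show "card {v :: int ^ 'm. int_vec_length v \<le> s} \<le> (2 * s + 1) ^ CARD('m)" .
qed

text \<open>
  An element of the box is a sum of fewer than \<open>r\<close> copies of each generator; staying with nonnegative
  coordinates avoids inverses of generators.
\<close>

lemma subadditive_on_box_le:
  fixes J :: "int ^ 'n \<Rightarrow> ennreal"
  assumes zero: "J 0 = 0" and add: "\<And>g g'. J (g + g') \<le> J g + J g'"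
    and gen: "\<And>i. J (axis i 1) \<le> e"
    and g: "\<And>i. g $ i \<in> {0..<int r}"
  shows "J g \<le> of_nat (CARD('n) * r) * e"
proof -
  have sum_le: "J (\<Sum>i\<in>I. F i) \<le> (\<Sum>i\<in>I. J (F i))" if "finite I" for I :: "'n set" and F
    using that
  proof induction
    case (insert i I)
    then show ?case
      using order_trans[OF add add_left_mono[OF insert.IH]] by simp
  qed (simp add: zero)
  have axis_le: "J (axis i (int q)) \<le> of_nat q * e" for i q
  proof (induction q)
    case 0
    have "axis i 0 = (0 :: int ^ 'n)"
      by (simp add: vec_eq_iff axis_def)
    then show ?case
      by (simp only: of_nat_0 mult_zero_left zero order_refl)
  next
    case (Suc q)
    have "axis i (int (Suc q)) = axis i (1 :: int) + axis i (int q)"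
      by (simp add: vec_eq_iff axis_def)
    then have "J (axis i (int (Suc q))) \<le> J (axis i 1) + J (axis i (int q))"
      by (metis add)
    also have "\<dots> \<le> e + of_nat q * e"
      by (intro add_mono gen Suc)
    finally show ?case
      by (simp add: algebra_simps)
  qed
  have "g = (\<Sum>i\<in>UNIV. axis i (g $ i))"
    by (simp add: vec_eq_iff axis_def sum.delta)
  then have "J g \<le> (\<Sum>i\<in>UNIV. J (axis i (g $ i)))"
    using sum_le[of UNIV "\<lambda>i. axis i (g $ i)"] by simp
  also have "\<dots> \<le> (\<Sum>i\<in>(UNIV :: 'n set). of_nat r * e)"
  proof (rule sum_mono)
    fix i
    have "J (axis i (g $ i)) \<le> of_nat (nat (g $ i)) * e"
      using axis_le[of i "nat (g $ i)"] g[of i] by simp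
    also have "\<dots> \<le> of_nat r * e"
      using g[of i] by (intro mult_right_mono of_nat_mono) auto
    finally show "J (axis i (g $ i)) \<le> of_nat r * e" .
  qed
  also have "\<dots> = of_nat (CARD('n) * r) * e"
    by (simp add: mult.assoc)
  finally show ?thesis .
qed

section \<open>Couplings between free abelian groups\<close>

text \<open>
  The generators are treated at once through \<open>f = max\<^sub>i \<rho>(\<kappa>(e\<^sub>i, x))\<close>, where \<open>\<rho>\<close> is the word length
  rescaled by a common constant \<open>C \<ge> c i\<close>. As the gauge is nondecreasing, \<open>f\<close> inherits integrability
  from the generators, and a single good scale \<open>t\<close> serves all of them. The choice \<open>r\<^sup>n \<ge> K t\<^sup>m\<close> puts
  more elements into the box than the counting bound \<open>O(t\<^sup>m)\<close> allows.
\<close>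

theorem strict_coupling_not_integrable:
  fixes M :: "'x measure"
    and a :: "int ^ 'n \<Rightarrow> 'x \<Rightarrow> 'x"
    and b :: "int ^ 'm \<Rightarrow> 'x \<Rightarrow> 'x"
  defines "p \<equiv> real CARD('m) / real CARD('n)"
  assumes "strict_coupling M a b Y"
    and dim: "CARD('n) > CARD('m)"
    and thr: "admissible_threshold p k T"
    and c: "\<And>i. c i > 0"
    and int: "\<And>i. (\<integral>\<^sup>+x. ennreal (varpi p k T
        (real (int_vec_length (strict_coupling.\<kappa> a b Y (axis i 1) x)) / c i))
          \<partial>strict_coupling.P M Y) < \<infinity>"
  shows False
proof -
  interpret strict_coupling M a b Y
    by fact
  have p: "0 < p" "p < 1"
    using dim by (auto simp: p_def)
  obtain L where L: "emeasure P (few_visits L) \<noteq> 0"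
    using few_visits_nonnull by blast
  define \<delta> where "\<delta> = measure P (few_visits L)"
  define \<mu> where "\<mu> = measure P Y"
  have \<delta>: "\<delta> > 0" "emeasure P (few_visits L) = ennreal \<delta>"
    using L by (auto simp: \<delta>_def P.emeasure_eq_measure zero_less_measure_iff)
  have \<mu>: "\<mu> \<ge> 0" "emeasure P Y = ennreal \<mu>"
    by (auto simp: \<mu>_def P.emeasure_eq_measure)
  define C where "C = max 1 (Max (range c))"
  have C: "C \<ge> 1" "C \<ge> c i" for i
    by (auto simp: C_def le_max_iff_disj)
  define \<rho> where "\<rho> h = real (int_vec_length h) / C" for h :: "int ^ 'm"
  have \<rho>_nonneg: "\<rho> h \<ge> 0" for h
    using C(1) by (simp add: \<rho>_def)
  have \<rho>_add: "\<rho> (h + h') \<le> \<rho> h + \<rho> h'" for h h'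
    unfolding \<rho>_def add_divide_distrib[symmetric] using C(1) int_vec_length_add[of h h']
    by (intro divide_right_mono) auto
  have \<rho>_0: "\<rho> 0 = 0"
    by (simp add: \<rho>_def int_vec_length_def)
  define f where "f x = Max ((\<lambda>i. \<rho> (\<kappa> (axis i 1) x)) ` UNIV)" for x
  have f_ge: "\<rho> (\<kappa> (axis i 1) x) \<le> f x" for i x
    unfolding f_def by (intro Max_ge) auto
  have f_attained: "\<exists>i. f x = \<rho> (\<kappa> (axis i 1) x)" for x
  proof -
    have "f x \<in> range (\<lambda>i. \<rho> (\<kappa> (axis i 1) x))"
      unfolding f_def by (rule Max_in) auto
    then show ?thesis
      by auto
  qed
  have f_measurable: "f \<in> borel_measurable P"
    unfolding f_def by (rule borel_measurable_Max) auto
  have f_nonneg: "f x \<ge> 0" for x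
    using f_attained[of x] \<rho>_nonneg by auto
  have f_int: "(\<integral>\<^sup>+x. ennreal (varpi p k T (f x)) \<partial>P) < \<infinity>"
  proof -
    let ?g = "\<lambda>i x. ennreal (varpi p k T (real (int_vec_length (\<kappa> (axis i 1) x)) / c i))"
    have "(\<integral>\<^sup>+x. ennreal (varpi p k T (f x)) \<partial>P) \<le> (\<integral>\<^sup>+x. (\<Sum>i\<in>UNIV. ?g i x) \<partial>P)"
    proof (rule nn_integral_mono)
      fix x
      obtain i where i: "f x = \<rho> (\<kappa> (axis i 1) x)"
        using f_attained by blast
      have "f x \<le> real (int_vec_length (\<kappa> (axis i 1) x)) / c i"
        unfolding i \<rho>_def using C(2)[of i] c[of i] by (intro divide_left_mono) auto
      then have "ennreal (varpi p k T (f x)) \<le> ?g i x"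
        by (intro ennreal_leI varpi_mono[OF thr])
      also have "\<dots> \<le> (\<Sum>i\<in>UNIV. ?g i x)"
        by (rule member_le_sum) auto
      finally show "ennreal (varpi p k T (f x)) \<le> (\<Sum>i\<in>UNIV. ?g i x)" .
    qed
    also have "\<dots> = (\<Sum>i\<in>UNIV. \<integral>\<^sup>+x. ?g i x \<partial>P)"
      by (rule nn_integral_sum) measurable
    also have "\<dots> < \<infinity>"
      using int by (simp add: less_top[symmetric])
    finally show ?thesis .
  qed
  define n where "n = CARD('n)"
  define m where "m = CARD('m)"
  have "n > 0"
    by (simp add: n_def)
  \<comment> \<open>The counting inequality will give \<open>K * t ^ m * \<delta> \<le> (K - 1) * t ^ m * \<delta>\<close>.\<close>
  define K where "K = 2 * real L * (2 * C + 1) ^ m * \<mu> / \<delta> + 1"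
  have K: "K \<ge> 1"
    using C(1) \<mu>(1) \<delta>(1) by (simp add: K_def)
  \<comment> \<open>Chosen so that \<open>n r \<eta> t powr (1 - p) \<le> t * (\<delta> / 2)\<close> for \<open>r \<le> 2 K t powr p\<close>.\<close>
  define \<eta> where "\<eta> = \<delta> / (4 * real n * K)"
  have \<eta>: "\<eta> > 0"
    using \<delta>(1) K \<open>n > 0\<close> by (simp add: \<eta>_def)
  obtain t where t: "t \<ge> 1"
    and small: "(\<integral>\<^sup>+x. ennreal (min (f x) t) \<partial>P) < ennreal (\<eta> * t powr (1 - p))"
    using truncated_moment_small[OF p thr P.finite_measure_axioms f_measurable f_nonneg f_int \<eta>, of 1]
    by blast
  define r where "r = nat \<lceil>K * t powr p\<rceil>"
  have tp: "t powr p \<ge> 1"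
    using t p by (intro ge_one_powr_ge_zero) auto
  have Ktp: "K * t powr p \<ge> 1"
    using mult_mono[OF K tp] K by simp
  have r: "K * t powr p \<le> real r" "real r \<le> 2 * K * t powr p"
    using Ktp unfolding r_def by linarith+
  define B where "B = {g :: int ^ 'n. \<forall>i. g $ i \<in> {0..<int r}}"
  have B: "finite B" "card B = r ^ n"
    unfolding B_def n_def using card_vec_box[where 'n = 'n, of "{0..<int r}"] by auto
  define s where "s = nat \<lfloor>C * t\<rfloor>"
  define S where "S = {h :: int ^ 'm. int_vec_length h \<le> s}"
  have S: "finite S" "card S \<le> (2 * s + 1) ^ m"
    unfolding S_def m_def by (rule int_vec_ball)+
  have long: "measure P {x \<in> Y. \<kappa> g x \<notin> S} \<le> \<delta> / 2" if "g \<in> B" for g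
  proof -
    \<comment> \<open>An element outside \<open>S\<close> has length at least \<open>\<lfloor>C t\<rfloor> + 1 > C t\<close>.\<close>
    have le_long: "measure P {x \<in> Y. \<kappa> g x \<notin> S} \<le> measure P {x \<in> Y. t \<le> \<rho> (\<kappa> g x)}"
    proof (rule P.finite_measure_mono)
      show "{x \<in> Y. \<kappa> g x \<notin> S} \<subseteq> {x \<in> Y. t \<le> \<rho> (\<kappa> g x)}"
      proof safe
        fix x assume "\<kappa> g x \<notin> S"
        then have "C * t \<le> real (int_vec_length (\<kappa> g x))"
          unfolding S_def s_def using t C(1) by (simp add: not_le) linarith
        then show "t \<le> \<rho> (\<kappa> g x)"
          unfolding \<rho>_def using C(1) by (simp add: pos_le_divide_eq mult.commute)
      qed
      have "{x \<in> space P. t \<le> \<rho> (\<kappa> g x)} \<in> sets P"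
        by measurable
      then show "{x \<in> Y. t \<le> \<rho> (\<kappa> g x)} \<in> sets P"
        by simp
    qed
    have "ennreal t * emeasure P {x \<in> Y. t \<le> \<rho> (\<kappa> g x)}
        \<le> ennreal (real (n * r) * (\<eta> * t powr (1 - p)))"
    proof -
      have "ennreal t * emeasure P {x \<in> Y. t \<le> \<rho> (\<kappa> g x)} \<le> truncated_length \<rho> t g"
        using t by (intro emeasure_long_le) simp
      also have "\<dots> \<le> of_nat (n * r) * (\<integral>\<^sup>+x. ennreal (min (f x) t) \<partial>P)"
        unfolding n_def
      proof (rule subadditive_on_box_le)
        show "truncated_length \<rho> t 0 = 0"
          using \<rho>_0 t by (intro truncated_length_0) auto
        show "truncated_length \<rho> t (g + g') \<le> truncated_length \<rho> t g + truncated_length \<rho> t g'" for g g'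
          using \<rho>_nonneg \<rho>_add t by (intro truncated_length_add) auto
        show "truncated_length \<rho> t (axis i 1) \<le> (\<integral>\<^sup>+x. ennreal (min (f x) t) \<partial>P)" for i
          unfolding truncated_length_def using f_ge
          by (intro nn_integral_mono ennreal_leI min.mono) auto
        show "g $ i \<in> {0..<int r}" for i
          using that by (simp add: B_def)
      qed
      also have "\<dots> \<le> of_nat (n * r) * ennreal (\<eta> * t powr (1 - p))"
        using small by (intro mult_left_mono) auto
      also have "\<dots> = ennreal (real (n * r) * (\<eta> * t powr (1 - p)))"
        by (simp only: ennreal_of_nat_eq_real_of_nat) (rule ennreal_mult[symmetric]; use \<eta> in simp)
      finally show ?thesis .
    qed
    then have "t * measure P {x \<in> Y. t \<le> \<rho> (\<kappa> g x)} \<le> real (n * r) * (\<eta> * t powr (1 - p))"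
      using t \<eta> by (simp add: P.emeasure_eq_measure ennreal_mult[symmetric] del: of_nat_mult)
    also have "\<dots> \<le> (real n * (2 * K * t powr p)) * (\<eta> * t powr (1 - p))"
      using r \<eta> by (intro mult_right_mono) (auto intro!: mult_left_mono)
    also have "\<dots> = t * (\<delta> / 2)"
    proof -
      have "t powr p * t powr (1 - p) = t"
        using t by (simp add: powr_add[symmetric])
      moreover have "(real n * (2 * K * t powr p)) * (\<eta> * t powr (1 - p))
          = (t powr p * t powr (1 - p)) * (2 * real n * K * \<eta>)"
        by (simp only: mult_ac)
      moreover have "2 * real n * K * \<eta> = \<delta> / 2"
        using K \<open>n > 0\<close> by (simp add: \<eta>_def field_simps)
      ultimately show ?thesis
        by simp
    qed
    finally have "measure P {x \<in> Y. t \<le> \<rho> (\<kappa> g x)} \<le> \<delta> / 2"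
      using t by simp
    with le_long show ?thesis
      by linarith
  qed
  have "ennreal (real (r ^ n) * \<delta>) \<le> ennreal (real (L * card S) * \<mu> + real (r ^ n) * (\<delta> / 2))"
  proof -
    have "ennreal (real (r ^ n) * \<delta>) = of_nat (card B) * emeasure P (few_visits L)"
      using \<delta>(1) unfolding \<delta>(2) B(2) ennreal_of_nat_eq_real_of_nat by (intro ennreal_mult) auto
    also have "\<dots> \<le> of_nat (L * card S) * emeasure P Y + (\<Sum>g\<in>B. emeasure P {x \<in> Y. \<kappa> g x \<notin> S})"
      using B(1) S(1) by (rule counting_inequality)
    also have "\<dots> \<le> of_nat (L * card S) * emeasure P Y + (\<Sum>g\<in>B. ennreal (\<delta> / 2))"
      using long by (intro add_left_mono sum_mono) (auto simp: P.emeasure_eq_measure intro: ennreal_leI)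
    also have "(\<Sum>g\<in>B. ennreal (\<delta> / 2)) = ennreal (real (r ^ n) * (\<delta> / 2))"
      unfolding sum_constant B(2) ennreal_of_nat_eq_real_of_nat
      using \<delta>(1) by (intro ennreal_mult[symmetric]) auto
    also have "of_nat (L * card S) * emeasure P Y = ennreal (real (L * card S) * \<mu>)"
      unfolding \<mu>(2) ennreal_of_nat_eq_real_of_nat using \<mu>(1) by (intro ennreal_mult[symmetric]) auto
    also have "ennreal (real (L * card S) * \<mu>) + ennreal (real (r ^ n) * (\<delta> / 2))
        = ennreal (real (L * card S) * \<mu> + real (r ^ n) * (\<delta> / 2))"
      using \<mu>(1) \<delta>(1) by (intro ennreal_plus[symmetric] mult_nonneg_nonneg) auto
    finally show ?thesis .
  qed
  then have "real (r ^ n) * \<delta> \<le> real (L * card S) * \<mu> + real (r ^ n) * (\<delta> / 2)"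
    using \<mu>(1) \<delta>(1) by (subst (asm) ennreal_le_iff) (auto intro!: add_nonneg_nonneg mult_nonneg_nonneg)
  then have main: "real (r ^ n) * \<delta> \<le> 2 * (real (L * card S) * \<mu>)"
    by simp
  have card_S: "real (card S) \<le> (2 * C + 1) ^ m * t ^ m"
  proof -
    have "real s \<le> C * t"
      using t C(1) by (simp add: s_def)
    then have "real (2 * s + 1) \<le> (2 * C + 1) * t"
      using t by (simp add: algebra_simps)
    have "real (card S) \<le> real ((2 * s + 1) ^ m)"
      using S(2) by (rule of_nat_mono)
    also have "\<dots> = real (2 * s + 1) ^ m"
      by simp
    also have "\<dots> \<le> ((2 * C + 1) * t) ^ m"
      using \<open>real (2 * s + 1) \<le> (2 * C + 1) * t\<close> by (intro power_mono) auto
    finally show ?thesis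
      by (simp add: power_mult_distrib)
  qed
  have "K * t ^ m \<le> real (r ^ n)"
  proof -
    have "K \<le> K ^ n"
      using K \<open>n > 0\<close> by (intro self_le_power) auto
    moreover have "(t powr p) ^ n = t ^ m"
    proof -
      have "(t powr p) ^ n = t powr (p * real n)"
        using t by (simp add: powr_powr[symmetric] powr_realpow)
      also have "p * real n = real m"
        by (simp add: p_def n_def m_def)
      finally show ?thesis
        using t by (simp add: powr_realpow)
    qed
    ultimately have "K * t ^ m \<le> (K * t powr p) ^ n"
      using t by (simp add: power_mult_distrib mult_right_mono)
    also have "\<dots> \<le> real r ^ n"
      using r(1) Ktp by (intro power_mono) auto
    finally show ?thesis
      by simp
  qed
  then have "(K * t ^ m) * \<delta> \<le> real (r ^ n) * \<delta>"
    using \<delta>(1) by (intro mult_right_mono) auto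
  also note main
  also have "2 * (real (L * card S) * \<mu>) \<le> 2 * (real L * ((2 * C + 1) ^ m * t ^ m) * \<mu>)"
    using card_S \<mu>(1) by (auto intro!: mult_left_mono mult_right_mono)
  also have "\<dots> = ((K - 1) * t ^ m) * \<delta>"
    using \<delta>(1) by (simp add: K_def)
  finally have "t ^ m * \<delta> \<le> 0"
    by (simp add: left_diff_distrib)
  moreover have "t ^ m * \<delta> > 0"
    using t \<delta>(1) by (intro mult_pos_pos zero_less_power) auto
  ultimately show False
    by simp
qed

theorem theorem1p3:
  fixes M :: "'x measure"
    and a :: "int ^ 'n \<Rightarrow> 'x \<Rightarrow> 'x"
    and b :: "int ^ 'm \<Rightarrow> 'x \<Rightarrow> 'x"
    and X\<^sub>G X\<^sub>H :: "'x set"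
    and k :: nat
    and T :: real
  assumes "CARD('n) > CARD('m)"
    and "admissible_threshold (real CARD('m) / real CARD('n)) k T"
    and "me_coupling M a b X\<^sub>G X\<^sub>H"
  shows "\<not> me_integrable (varpi (real CARD('m) / real CARD('n)) k T) int_vec_length M a b X\<^sub>H"
proof
  define w where "w = varpi (real CARD('m) / real CARD('n)) k T"
  assume integrable: "me_integrable (varpi (real CARD('m) / real CARD('n)) k T) int_vec_length M a b X\<^sub>H"
  have "\<exists>c>0. (\<integral>\<^sup>+x\<in>X\<^sub>H. ennreal (w (real (int_vec_length (cocycle a b X\<^sub>H (axis i 1) x)) / c)) \<partial>M) < \<infinity>"
    for i :: 'n
    using integrable unfolding me_integrable_def w_def[symmetric] by (rule spec)
  then have "\<forall>i :: 'n. \<exists>c. c > 0 \<and>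
      (\<integral>\<^sup>+x\<in>X\<^sub>H. ennreal (w (real (int_vec_length (cocycle a b X\<^sub>H (axis i 1) x)) / c)) \<partial>M) < \<infinity>"
    by (rule allI)
  from choice[OF this] obtain c where c: "\<And>i. c i > 0"
    and int: "\<And>i. (\<integral>\<^sup>+x\<in>X\<^sub>H. ennreal (w (real (int_vec_length (cocycle a b X\<^sub>H (axis i 1) x)) / c i)) \<partial>M) < \<infinity>"
    by blast
  obtain \<Omega> where \<Omega>: "\<Omega> \<in> sets M" "AE x in M. x \<in> \<Omega>"
    and strict: "strict_coupling (restrict_space M \<Omega>) a b (X\<^sub>H \<inter> \<Omega>)"
    and \<kappa>: "\<And>g x. x \<in> X\<^sub>H \<inter> \<Omega> \<Longrightarrow> cocycle a b X\<^sub>H g x = strict_coupling.\<kappa> a b (X\<^sub>H \<inter> \<Omega>) g x"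
    using me_coupling_strict[OF assms(3)] by blast
  interpret strict_coupling "restrict_space M \<Omega>" a b "X\<^sub>H \<inter> \<Omega>"
    by (rule strict)
  show False
  proof (rule strict_coupling_not_integrable[OF strict assms(1,2)])
    show "c i > 0" for i
      by (rule c)
    fix i
    have "(\<integral>\<^sup>+x. ennreal (w (real (int_vec_length (\<kappa> (axis i 1) x)) / c i)) \<partial>P)
        = (\<integral>\<^sup>+x\<in>X\<^sub>H. ennreal (w (real (int_vec_length (cocycle a b X\<^sub>H (axis i 1) x)) / c i)) \<partial>M)"
      unfolding nn_integral_P using \<Omega>(1)
    proof (subst nn_integral_restrict_space, simp, intro nn_integral_cong_AE)
      show "AE x in M.
          ennreal (w (real (int_vec_length (\<kappa> (axis i 1) x)) / c i)) * indicator (X\<^sub>H \<inter> \<Omega>) x * indicator \<Omega> x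
          = ennreal (w (real (int_vec_length (cocycle a b X\<^sub>H (axis i 1) x)) / c i)) * indicator X\<^sub>H x"
        using \<Omega>(2) by eventually_elim (auto simp: \<kappa> indicator_def)
    qed
    then show "(\<integral>\<^sup>+x. ennreal (varpi (real CARD('m) / real CARD('n)) k T
        (real (int_vec_length (\<kappa> (axis i 1) x)) / c i)) \<partial>P) < \<infinity>"
      using int[of i] by (simp add: w_def)
  qed
qed

end
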